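(* Let $n\ge1$, let $E_n = \wedge\{\alpha_1,\dots,\alpha_n,\theta_1,\dots,\theta_n\}$ be the exterior algebra over $\mathbb{C}$, let $T:E_n\to E_n$ be the algebra homomorphism with $T(\theta_i)=\theta_i+\alpha_i$, $T(\alpha_i)=\alpha_i$, let $H^0(M,\mathcal{O})=\{f\in E_n: T(f)=f\}$ and $H^1(M,\mathcal{O}) = E_n/\{T(f)-f : f\in E_n\}$. Let $\mathrm{vol}_n=\alpha_1\cdots\alpha_n\cdot\theta_1\cdots\theta_n$ and define a bilinear form on $E_n$ by $\langle f,g\rangle = $ the coefficient of $\mathrm{vol}_n$ in $f\cdot g$. Then $\langle-,-\rangle$ induces a well-defined perfect pairing $H^0(M,\mathcal{O})\otimes H^1(M,\mathcal{O})\to\mathbb{C}$, $f\otimes (g + \{T(h)-h\}) \mapsto \langle f, g\rangle$.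
   Context: A bilinear pairing $V\otimes W\to\mathbb{C}$ of finite-dimensional spaces is perfect if every nonzero $v\in V$ pairs nontrivially with some $w\in W$ and every nonzero $w\in W$ pairs nontrivially with some $v\in V$. *)

theory Defs
  imports Complex_Main "HOL-Algebra.AbelCoset" "Jordan_Normal_Form.VS_Connect"
begin

section \<open>The exterior algebra on a finite ordered set of generators\<close>

text \<open>
  An element is given by its coefficients in the monomial basis: for finite \<open>S \<subseteq> I\<close>, the basis
  element \<open>e\<^sub>S\<close> is the product of the generators in \<open>S\<close> in increasing order, and \<open>f\<close> stands for
  the sum of the \<open>f S \<cdot> e\<^sub>S\<close>. For disjoint \<open>A\<close>, \<open>B\<close> one has \<open>e\<^sub>A e\<^sub>B = shuffle_sign A B \<cdot> e\<^sub>A\<^sub>\<union>\<^sub>B\<close>; for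
  non-disjoint \<open>A\<close>, \<open>B\<close> the product vanishes.
\<close>

definition inversions :: "'i::linorder set \<Rightarrow> 'i set \<Rightarrow> ('i \<times> 'i) set" where
  "inversions A B = {(a, b) \<in> A \<times> B. b < a}"

definition shuffle_sign :: "'i::linorder set \<Rightarrow> 'i set \<Rightarrow> complex" where
  "shuffle_sign A B = (- 1) ^ card (inversions A B)"

definition wedge :: "('i::linorder set \<Rightarrow> complex) \<Rightarrow> ('i set \<Rightarrow> complex) \<Rightarrow> 'i set \<Rightarrow> complex" where
  "wedge f g = (\<lambda>S. \<Sum>A\<in>Pow S. shuffle_sign A (S - A) * f A * g (S - A))"

definition monomial :: "'i set \<Rightarrow> 'i set \<Rightarrow> complex" where
  "monomial A = (\<lambda>S. if S = A then 1 else 0)"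

definition exterior_algebra :: "'i::linorder set \<Rightarrow> (complex, 'i set \<Rightarrow> complex) module" where
  "exterior_algebra I =
    \<lparr>carrier = {f. \<forall>S. f S \<noteq> 0 \<longrightarrow> S \<subseteq> I},
     mult = wedge,
     one = monomial {},
     zero = (\<lambda>_. 0),
     add = (\<lambda>f g S. f S + g S),
     smult = (\<lambda>c f S. c * f S)\<rparr>"

definition algebra_hom ::
  "('k, 'c) ring_scheme \<Rightarrow> ('k, 'a, 'd) module_scheme \<Rightarrow> ('k, 'b, 'e) module_scheme \<Rightarrow> ('a \<Rightarrow> 'b) set"
  where "algebra_hom K A B = Ring.ring_hom A B \<inter> LinearCombinations.module_hom K A B"


section \<open>Quotient spaces and perfect pairings\<close>

text \<open>
  The scalar product \<open>c \<cdot> (U + x) = U + c x\<close> is written as a union over all representatives \<open>x\<close>.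
  The fields \<open>mult\<close> and \<open>one\<close>, which a module inherits from the record of rings, carry no meaning.
\<close>

definition quotient_space :: "('k, 'a) module \<Rightarrow> 'a set \<Rightarrow> ('k, 'a set) module" where
  "quotient_space V U =
    \<lparr>carrier = a_rcosets\<^bsub>V\<^esub> U,
     mult = undefined,
     one = undefined,
     zero = U,
     add = (\<lambda>X Y. X <+>\<^bsub>V\<^esub> Y),
     smult = (\<lambda>c X. \<Union>x\<in>X. U +>\<^bsub>V\<^esub> (c \<odot>\<^bsub>V\<^esub> x))\<rparr>"

locale bilinear_pairing = V: vectorspace K V + W: vectorspace K W
  for K :: "('k, 'c) ring_scheme" (structure) and V :: "('k, 'v, 'd) module_scheme"
    and W :: "('k, 'w, 'e) module_scheme" +
  fixes p :: "'v \<Rightarrow> 'w \<Rightarrow> 'k"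
  assumes closed: "\<lbrakk>v \<in> carrier V; w \<in> carrier W\<rbrakk> \<Longrightarrow> p v w \<in> carrier K"
    and add_left: "\<lbrakk>v \<in> carrier V; v' \<in> carrier V; w \<in> carrier W\<rbrakk>
      \<Longrightarrow> p (v \<oplus>\<^bsub>V\<^esub> v') w = p v w \<oplus> p v' w"
    and smult_left: "\<lbrakk>c \<in> carrier K; v \<in> carrier V; w \<in> carrier W\<rbrakk>
      \<Longrightarrow> p (c \<odot>\<^bsub>V\<^esub> v) w = c \<otimes> p v w"
    and add_right: "\<lbrakk>v \<in> carrier V; w \<in> carrier W; w' \<in> carrier W\<rbrakk>
      \<Longrightarrow> p v (w \<oplus>\<^bsub>W\<^esub> w') = p v w \<oplus> p v w'"
    and smult_right: "\<lbrakk>c \<in> carrier K; v \<in> carrier V; w \<in> carrier W\<rbrakk>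
      \<Longrightarrow> p v (c \<odot>\<^bsub>W\<^esub> w) = c \<otimes> p v w"

locale perfect_pairing = bilinear_pairing +
  assumes fin_dim_left: "V.fin_dim"
    and fin_dim_right: "W.fin_dim"
    and nondegenerate_left: "\<lbrakk>v \<in> carrier V; v \<noteq> \<zero>\<^bsub>V\<^esub>\<rbrakk> \<Longrightarrow> \<exists>w\<in>carrier W. p v w \<noteq> \<zero>"
    and nondegenerate_right: "\<lbrakk>w \<in> carrier W; w \<noteq> \<zero>\<^bsub>W\<^esub>\<rbrakk> \<Longrightarrow> \<exists>v\<in>carrier V. p v w \<noteq> \<zero>"


section \<open>The algebra $E_n$, its cohomology and its pairing\<close>

text \<open>
  The \<open>2n\<close> generators are numbered \<open>\<alpha>\<^sub>1, \<dots>, \<alpha>\<^sub>n, \<theta>\<^sub>1, \<dots>, \<theta>\<^sub>n\<close>; as \<open>\<theta>\<^sub>i\<close> is generator number \<open>n + i\<close>,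
  it depends on \<open>n\<close>.
\<close>

definition E :: "nat \<Rightarrow> (complex, nat set \<Rightarrow> complex) module" where
  "E n = exterior_algebra {1..2 * n}"

definition alpha :: "nat \<Rightarrow> nat set \<Rightarrow> complex" where
  "alpha i = monomial {i}"

definition theta :: "nat \<Rightarrow> nat \<Rightarrow> nat set \<Rightarrow> complex" where
  "theta n i = monomial {n + i}"

definition list_prod :: "('a, 'b) monoid_scheme \<Rightarrow> 'a list \<Rightarrow> 'a" where
  "list_prod G xs = foldr (\<otimes>\<^bsub>G\<^esub>) xs \<one>\<^bsub>G\<^esub>"

definition vol :: "nat \<Rightarrow> nat set \<Rightarrow> complex" where
  "vol n = list_prod (E n) (map alpha [1..<Suc n]) \<otimes>\<^bsub>E n\<^esub> list_prod (E n) (map (theta n) [1..<Suc n])"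

text \<open>
  The top degree part of \<open>f g\<close> is a multiple of \<open>vol n\<close>; both are determined by their coefficient
  at the monomial of the full set of generators. That monomial is in fact \<open>vol n\<close>, see
  \<open>vol_eq_monomial\<close>.
\<close>

definition vol_pairing :: "nat \<Rightarrow> (nat set \<Rightarrow> complex) \<Rightarrow> (nat set \<Rightarrow> complex) \<Rightarrow> complex" where
  "vol_pairing n f g = (f \<otimes>\<^bsub>E n\<^esub> g) {1..2 * n} / vol n {1..2 * n}"

definition H0 :: "nat \<Rightarrow> ((nat set \<Rightarrow> complex) \<Rightarrow> nat set \<Rightarrow> complex) \<Rightarrow>
    (complex, nat set \<Rightarrow> complex) module" where
  "H0 n T = (E n)\<lparr>carrier := {f \<in> carrier (E n). T f = f}\<rparr>"

definition coboundaries :: "nat \<Rightarrow> ((nat set \<Rightarrow> complex) \<Rightarrow> nat set \<Rightarrow> complex) \<Rightarrow>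
    (nat set \<Rightarrow> complex) set" where
  "coboundaries n T = {T f \<ominus>\<^bsub>E n\<^esub> f | f. f \<in> carrier (E n)}"

definition H1 :: "nat \<Rightarrow> ((nat set \<Rightarrow> complex) \<Rightarrow> nat set \<Rightarrow> complex) \<Rightarrow>
    (complex, (nat set \<Rightarrow> complex) set) module" where
  "H1 n T = quotient_space (E n) (coboundaries n T)"

section \<open>Basic properties\<close>

lemma finite_inversions: "finite A \<Longrightarrow> finite B \<Longrightarrow> finite (inversions A B)"
  unfolding inversions_def by (rule finite_subset[of _ "A \<times> B"]) auto

lemma shuffle_sign_Un_left:
  assumes "finite A" "finite B" "finite C" "A \<inter> B = {}"
  shows "shuffle_sign (A \<union> B) C = shuffle_sign A C * shuffle_sign B C"
proof -
  have "inversions (A \<union> B) C = inversions A C \<union> inversions B C"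
    "inversions A C \<inter> inversions B C = {}"
    using assms(4) by (auto simp: inversions_def)
  then show ?thesis
    using assms by (simp add: shuffle_sign_def card_Un_disjoint finite_inversions power_add)
qed

lemma shuffle_sign_Un_right:
  assumes "finite A" "finite B" "finite C" "B \<inter> C = {}"
  shows "shuffle_sign A (B \<union> C) = shuffle_sign A B * shuffle_sign A C"
proof -
  have "inversions A (B \<union> C) = inversions A B \<union> inversions A C"
    "inversions A B \<inter> inversions A C = {}"
    using assms(4) by (auto simp: inversions_def)
  then show ?thesis
    using assms by (simp add: shuffle_sign_def card_Un_disjoint finite_inversions power_add)
qed

lemma shuffle_sign_empty [simp]: "shuffle_sign {} B = 1" "shuffle_sign A {} = 1"
  by (simp_all add: shuffle_sign_def inversions_def)

lemma shuffle_sign_less: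
  assumes "\<And>a b. a \<in> A \<Longrightarrow> b \<in> B \<Longrightarrow> a < b"
  shows "shuffle_sign A B = 1"
proof -
  have "inversions A B = {}"
    using assms by (fastforce simp: inversions_def)
  then show ?thesis
    by (simp add: shuffle_sign_def)
qed

lemma wedge_infinite: "infinite S \<Longrightarrow> wedge f g S = 0"
  by (simp add: wedge_def)

lemma wedge_assoc: "wedge (wedge f g) h = wedge f (wedge g h)"
proof
  fix S
  show "wedge (wedge f g) h S = wedge f (wedge g h) S"
  proof (cases "finite S")
    case False
    then show ?thesis by (simp add: wedge_infinite)
  next
    case fin: True
    then have finS: "finite A" if "A \<subseteq> S" for A
      using that finite_subset by blast
    have "wedge (wedge f g) h S = (\<Sum>C\<in>Pow S. \<Sum>A\<in>Pow C.
        shuffle_sign C (S - C) * (shuffle_sign A (C - A) * f A * g (C - A)) * h (S - C))"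
      by (simp add: wedge_def sum_distrib_left sum_distrib_right)
    also have "\<dots> = (\<Sum>(C, A)\<in>Sigma (Pow S) Pow.
        shuffle_sign C (S - C) * (shuffle_sign A (C - A) * f A * g (C - A)) * h (S - C))"
      by (rule sum.Sigma) (auto simp: fin finS)
    also have "\<dots> = (\<Sum>(A, B)\<in>Sigma (Pow S) (\<lambda>A. Pow (S - A)).
        shuffle_sign A (S - A) * f A * (shuffle_sign B (S - A - B) * g B * h (S - A - B)))"
    proof (rule sum.reindex_bij_witness[where j = "\<lambda>(C, A). (A, C - A)" and i = "\<lambda>(A, B). (A \<union> B, A)"])
      fix x assume "x \<in> Sigma (Pow S) Pow"
      then obtain C A where x: "x = (C, A)" "A \<subseteq> C" "C \<subseteq> S" by auto
      let ?B = "C - A" and ?D = "S - C"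
      have D: "S - A - ?B = ?D" "C = A \<union> ?B" "S - A = ?B \<union> ?D"
        using x by auto
      have f: "finite A" "finite ?B" "finite ?D"
        using x fin finS by auto
      have "shuffle_sign C ?D = shuffle_sign A ?D * shuffle_sign ?B ?D"
        using shuffle_sign_Un_left[of A ?B ?D] f x D(2) by auto
      moreover have "shuffle_sign A (S - A) = shuffle_sign A ?B * shuffle_sign A ?D"
        unfolding D(3) by (rule shuffle_sign_Un_right) (use f in auto)
      ultimately show "(case case x of (C, A) \<Rightarrow> (A, C - A) of (A, B) \<Rightarrow>
          shuffle_sign A (S - A) * f A * (shuffle_sign B (S - A - B) * g B * h (S - A - B))) =
        (case x of (C, A) \<Rightarrow>
          shuffle_sign C (S - C) * (shuffle_sign A (C - A) * f A * g (C - A)) * h (S - C))"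
        by (simp add: x(1) D(1))
    qed auto
    also have "\<dots> = (\<Sum>A\<in>Pow S. \<Sum>B\<in>Pow (S - A).
        shuffle_sign A (S - A) * f A * (shuffle_sign B (S - A - B) * g B * h (S - A - B)))"
      by (rule sum.Sigma[symmetric]) (auto simp: fin)
    also have "\<dots> = wedge f (wedge g h) S"
      by (simp add: wedge_def sum_distrib_left sum_distrib_right)
    finally show ?thesis .
  qed
qed

lemma wedge_add_left: "wedge (\<lambda>S. f S + g S) h = (\<lambda>S. wedge f h S + wedge g h S)"
  by (rule ext) (simp add: wedge_def sum.distrib algebra_simps)

lemma wedge_add_right: "wedge h (\<lambda>S. f S + g S) = (\<lambda>S. wedge h f S + wedge h g S)"
  by (rule ext) (simp add: wedge_def sum.distrib algebra_simps)

lemma wedge_smult_left: "wedge (\<lambda>S. c * f S) g = (\<lambda>S. c * wedge f g S)"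
  by (rule ext) (simp add: wedge_def sum_distrib_left algebra_simps)

lemma wedge_smult_right: "wedge f (\<lambda>S. c * g S) = (\<lambda>S. c * wedge f g S)"
  by (rule ext) (simp add: wedge_def sum_distrib_left algebra_simps)

lemma wedge_monomial_left:
  assumes "finite S"
  shows "wedge (monomial A) g S = (if A \<subseteq> S then shuffle_sign A (S - A) * g (S - A) else 0)"
proof -
  have "wedge (monomial A) g S =
      (\<Sum>B\<in>Pow S. if B = A then shuffle_sign A (S - A) * g (S - A) else 0)"
    unfolding wedge_def by (rule sum.cong) (auto simp: monomial_def)
  then show ?thesis using assms by (simp add: sum.delta)
qed

lemma wedge_monomial:
  assumes "finite A" "finite B"
  shows "wedge (monomial A) (monomial B) =
    (if A \<inter> B = {} then (\<lambda>S. shuffle_sign A B * monomial (A \<union> B) S) else (\<lambda>_. 0))"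
proof
  fix S :: "'a set"
  show "wedge (monomial A) (monomial B) S =
    (if A \<inter> B = {} then (\<lambda>S. shuffle_sign A B * monomial (A \<union> B) S) else (\<lambda>_. 0)) S"
  proof (cases "finite S")
    case True
    then show ?thesis
      by (subst wedge_monomial_left) (auto simp: monomial_def)
  next
    case False
    then have "S \<noteq> A \<union> B" using assms by auto
    then show ?thesis using False by (auto simp: wedge_infinite monomial_def)
  qed
qed

lemma wedge_gen_self: "wedge (monomial {i}) (monomial {i}) = (\<lambda>_. 0)"
  by (simp add: wedge_monomial)

lemma wedge_gen_anticommute:
  "wedge (monomial {i}) (monomial {j}) = (\<lambda>S. - wedge (monomial {j}) (monomial {i}) S)"
proof (cases "i = j")
  case True
  then show ?thesis by (simp add: wedge_gen_self)
next
  case False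
  have "inversions {i} {j} = (if j < i then {(i, j)} else {})" for i j :: 'a
    by (auto simp: inversions_def)
  then have "shuffle_sign {i} {j} = - shuffle_sign {j} {i}"
    using False by (auto simp: shuffle_sign_def)
  with False show ?thesis
    by (auto simp: wedge_monomial insert_commute)
qed

lemma exterior_algebra_simps:
  "carrier (exterior_algebra I) = {f. \<forall>S. f S \<noteq> 0 \<longrightarrow> S \<subseteq> I}"
  "mult (exterior_algebra I) = wedge"
  "one (exterior_algebra I) = monomial {}"
  "zero (exterior_algebra I) = (\<lambda>_. 0)"
  "add (exterior_algebra I) = (\<lambda>f g S. f S + g S)"
  "module.smult (exterior_algebra I) = (\<lambda>c f S. c * f S)"
  by (simp_all add: exterior_algebra_def)

lemma wedge_closed:
  assumes "f \<in> carrier (exterior_algebra I)" "g \<in> carrier (exterior_algebra I)"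
  shows "wedge f g \<in> carrier (exterior_algebra I)"
proof -
  have "S \<subseteq> I" if "wedge f g S \<noteq> 0" for S
  proof -
    from that obtain A where A: "A \<in> Pow S" "shuffle_sign A (S - A) * f A * g (S - A) \<noteq> 0"
      unfolding wedge_def by (rule sum.not_neutral_contains_not_neutral)
    then have "A \<subseteq> I" "S - A \<subseteq> I" using assms by (auto simp: exterior_algebra_simps)
    then show ?thesis by auto
  qed
  then show ?thesis by (simp add: exterior_algebra_simps)
qed

lemma wedge_one:
  assumes "f \<in> carrier (exterior_algebra I)" "finite I"
  shows "wedge (monomial {}) f = f" "wedge f (monomial {}) = f"
proof -
  have inf: "f S = 0" if "infinite S" for S
    using assms that by (simp add: exterior_algebra_simps) (meson finite_subset)
  show "wedge (monomial {}) f = f"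
  proof
    fix S show "wedge (monomial {}) f S = f S"
      by (cases "finite S") (simp_all add: wedge_monomial_left wedge_infinite inf)
  qed
  show "wedge f (monomial {}) = f"
  proof
    fix S show "wedge f (monomial {}) S = f S"
    proof (cases "finite S")
      case True
      have "wedge f (monomial {}) S = (\<Sum>A\<in>Pow S. if A = S then f S else 0)"
        unfolding wedge_def by (rule sum.cong) (auto simp: monomial_def)
      then show ?thesis using True by (simp add: sum.delta)
    qed (simp add: wedge_infinite inf)
  qed
qed

lemma exterior_algebra_abelian_group: "abelian_group (exterior_algebra I)"
proof (rule abelian_groupI)
  fix f assume "f \<in> carrier (exterior_algebra I)"
  then show "\<exists>g\<in>carrier (exterior_algebra I). g \<oplus>\<^bsub>exterior_algebra I\<^esub> f = \<zero>\<^bsub>exterior_algebra I\<^esub>"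
    by (intro bexI[of _ "\<lambda>S. - f S"]) (auto simp: exterior_algebra_simps)
next
  fix f g assume "f \<in> carrier (exterior_algebra I)" "g \<in> carrier (exterior_algebra I)"
  then show "f \<oplus>\<^bsub>exterior_algebra I\<^esub> g \<in> carrier (exterior_algebra I)"
    by (simp add: exterior_algebra_simps) (metis add.left_neutral)
qed (auto simp: exterior_algebra_simps algebra_simps)

lemma exterior_algebra_ring:
  assumes "finite I"
  shows "ring (exterior_algebra I)"
proof (rule ringI[OF exterior_algebra_abelian_group])
  show "Group.monoid (exterior_algebra I)"
    by (rule monoidI) (use assms in \<open>auto simp: wedge_closed wedge_assoc wedge_one
      exterior_algebra_simps(2,3)\<close>, auto simp: exterior_algebra_simps monomial_def)
qed (auto simp: exterior_algebra_simps wedge_add_left wedge_add_right)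

lemma exterior_algebra_vectorspace: "vectorspace class_ring (exterior_algebra I)"
proof (intro vectorspace.intro)
  show "Module.module class_ring (exterior_algebra I)"
    by (rule moduleI[OF _ exterior_algebra_abelian_group])
      (auto simp: exterior_algebra_simps algebra_simps class_cring.cring_axioms)
  show "field (class_ring :: complex ring)"
    by (rule class_field.field_axioms)
qed

lemma list_prod_gens:
  assumes "finite I" "sorted_wrt (<) xs" "set xs \<subseteq> I"
  shows "list_prod (exterior_algebra I) (map (\<lambda>i. monomial {i}) xs) = monomial (set xs)"
  using assms(2,3)
proof (induction xs)
  case Nil
  then show ?case by (simp add: list_prod_def exterior_algebra_simps)
next
  case (Cons a xs)
  have "shuffle_sign {a} (set xs) = 1"
    using Cons.prems by (intro shuffle_sign_less) auto
  then show ?case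
    using Cons by (auto simp: list_prod_def exterior_algebra_simps wedge_monomial)
qed

lemma vol_eq_monomial: "vol n = monomial {1..2 * n}"
proof -
  have 1: "list_prod (E n) (map alpha [1..<Suc n]) = monomial {1..n}"
    using list_prod_gens[of "{1..2 * n}" "[1..<Suc n]"]
    by (simp add: E_def alpha_def[abs_def] atLeastLessThanSuc_atLeastAtMost sorted_wrt_upt
        del: upt_Suc)
  have set: "set (map ((+) n) [1..<Suc n]) = {Suc n..2 * n}"
    by (simp add: image_add_atLeastLessThan mult_2 atLeastLessThanSuc_atLeastAtMost del: upt_Suc)
  have "map (theta n) [1..<Suc n] = map (\<lambda>i. monomial {i}) (map ((+) n) [1..<Suc n])"
    by (simp add: theta_def[abs_def] o_def del: upt_Suc)
  then have 2: "list_prod (E n) (map (theta n) [1..<Suc n]) = monomial {Suc n..2 * n}"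
    using list_prod_gens[of "{1..2 * n}" "map ((+) n) [1..<Suc n]"] set
    by (simp add: E_def sorted_wrt_map sorted_wrt_upt del: upt_Suc map_map list.map_comp set_map)
  have "shuffle_sign {1..n} {Suc n..2 * n} = 1"
    by (rule shuffle_sign_less) auto
  moreover have "{1..n} \<union> {Suc n..2 * n} = {1..2 * n}" "{1..n} \<inter> {Suc n..2 * n} = {}"
    by auto
  ultimately show ?thesis
    unfolding vol_def 1 2 by (simp add: E_def exterior_algebra_simps wedge_monomial)
qed

text \<open>
  Universal property: generators may be sent to any anticommuting elements (here, of an exterior
  algebra). In particular, the endomorphism with \<open>\<theta>\<^sub>i \<mapsto> \<theta>\<^sub>i + \<alpha>\<^sub>i\<close> and \<open>\<alpha>\<^sub>i \<mapsto> \<alpha>\<^sub>i\<close> exists and is unique.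
\<close>

definition mprod :: "('i::linorder \<Rightarrow> 'j::linorder set \<Rightarrow> complex) \<Rightarrow> 'i set \<Rightarrow> 'j set \<Rightarrow> complex" where
  "mprod y S = foldr wedge (map y (sorted_list_of_set S)) (monomial {})"

definition lift :: "'i::linorder set \<Rightarrow> ('i \<Rightarrow> 'j::linorder set \<Rightarrow> complex) \<Rightarrow>
    ('i set \<Rightarrow> complex) \<Rightarrow> 'j set \<Rightarrow> complex" where
  "lift I y f = (\<lambda>R. \<Sum>S\<in>Pow I. f S * mprod y S R)"

lemma wedge_zero: "wedge (\<lambda>_. 0) f = (\<lambda>_. 0)" "wedge f (\<lambda>_. 0) = (\<lambda>_. 0)"
  by (auto simp: wedge_def)

lemma wedge_sum_left: "wedge (\<lambda>S. \<Sum>x\<in>X. c x * F x S) G = (\<lambda>S. \<Sum>x\<in>X. c x * wedge (F x) G S)"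
  by (rule ext, simp add: wedge_def sum_distrib_left sum_distrib_right, subst sum.swap)
    (simp add: mult_ac)

lemma wedge_sum_right: "wedge G (\<lambda>S. \<Sum>x\<in>X. c x * F x S) = (\<lambda>S. \<Sum>x\<in>X. c x * wedge G (F x) S)"
  by (rule ext, simp add: wedge_def sum_distrib_left sum_distrib_right, subst sum.swap)
    (simp add: mult_ac)

lemma mprod_empty [simp]: "mprod y {} = monomial {}"
  by (simp add: mprod_def)

lemma mprod_insert_min:
  assumes "finite S" "\<And>s. s \<in> S \<Longrightarrow> a < s"
  shows "mprod y (insert a S) = wedge (y a) (mprod y S)"
proof -
  have "a \<notin> S" using assms(2) by auto
  then have "sorted_list_of_set (insert a S) = insort a (sorted_list_of_set S)"
    using assms(1) by simp
  also have "\<dots> = a # sorted_list_of_set S"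
    by (rule insort_is_Cons) (use assms in \<open>auto intro: less_imp_le\<close>)
  finally show ?thesis by (simp add: mprod_def)
qed

context
  fixes I :: "'i::linorder set" and J :: "'j::linorder set" and y :: "'i \<Rightarrow> 'j set \<Rightarrow> complex"
  assumes fin: "finite I" "finite J"
    and y_carrier: "\<And>i. i \<in> I \<Longrightarrow> y i \<in> carrier (exterior_algebra J)"
    and y_anti: "\<And>i j. i \<in> I \<Longrightarrow> j \<in> I \<Longrightarrow> wedge (y i) (y j) = (\<lambda>S. - wedge (y j) (y i) S)"
begin

lemma mprod_carrier:
  assumes "S \<subseteq> I"
  shows "mprod y S \<in> carrier (exterior_algebra J)"
proof -
  have "finite S" using assms fin finite_subset by auto
  then show ?thesis using assms
  proof (induction rule: finite_linorder_min_induct)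
    case empty
    then show ?case by (simp add: exterior_algebra_simps monomial_def)
  next
    case (insert b A)
    then show ?case by (simp add: mprod_insert_min wedge_closed y_carrier)
  qed
qed

lemma y_self: "i \<in> I \<Longrightarrow> wedge (y i) (y i) = (\<lambda>_. 0)"
proof
  fix S assume "i \<in> I"
  then have "wedge (y i) (y i) S = - wedge (y i) (y i) S"
    using y_anti[of i i] by (rule_tac fun_cong) auto
  then show "wedge (y i) (y i) S = 0" by simp
qed

lemma wedge_y_mprod:
  assumes "a \<in> I" "B \<subseteq> I"
  shows "wedge (y a) (mprod y B) =
    (if a \<in> B then (\<lambda>_. 0) else (\<lambda>S. shuffle_sign {a} B * mprod y (insert a B) S))"
proof -
  have "finite B" using assms fin finite_subset by auto
  then show ?thesis using assms(2)
  proof (induction rule: finite_linorder_min_induct)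
    case empty
    then show ?case using mprod_insert_min[of "{}" a y] by simp
  next
    case (insert b B)
    have b: "b \<in> I" "B \<subseteq> I" "finite B" "b \<notin> B" using insert by auto
    have mb: "mprod y (insert b B) = wedge (y b) (mprod y B)"
      using insert by (simp add: mprod_insert_min)
    consider "a < b" | "a = b" | "b < a" by fastforce
    then show ?case
    proof cases
      case 1
      then have less: "a < s" if "s \<in> insert b B" for s using insert that by auto
      then have "a \<notin> insert b B" by blast
      moreover have "shuffle_sign {a} (insert b B) = 1"
        by (rule shuffle_sign_less) (use less in auto)
      moreover have "mprod y (insert a (insert b B)) = wedge (y a) (mprod y (insert b B))"
        by (rule mprod_insert_min) (use less b in auto)
      ultimately show ?thesis by simp
    next
      case 2
      then show ?thesis
        using assms(1) by (simp add: mb wedge_assoc[symmetric] y_self wedge_zero)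
    next
      case 3
      have "wedge (y a) (mprod y (insert b B)) = wedge (wedge (y a) (y b)) (mprod y B)"
        by (simp add: mb wedge_assoc)
      also have "\<dots> = wedge (\<lambda>S. - 1 * wedge (y b) (y a) S) (mprod y B)"
        using y_anti[of a b] assms(1) b by simp
      also have "\<dots> = (\<lambda>S. - 1 * wedge (y b) (wedge (y a) (mprod y B)) S)"
        by (simp only: wedge_smult_left wedge_assoc)
      also have "\<dots> = (if a \<in> insert b B then (\<lambda>_. 0)
          else (\<lambda>S. shuffle_sign {a} (insert b B) * mprod y (insert a (insert b B)) S))"
      proof (cases "a \<in> B")
        case True
        then show ?thesis using insert.IH b by (simp add: wedge_zero)
      next
        case False
        have "inversions {a} {b} = {(a, b)}" using 3 by (auto simp: inversions_def)
        then have "shuffle_sign {a} (insert b B) = - shuffle_sign {a} B"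
          using shuffle_sign_Un_right[of "{a}" "{b}" B] b by (simp add: shuffle_sign_def)
        moreover have "mprod y (insert b (insert a B)) = wedge (y b) (mprod y (insert a B))"
          by (rule mprod_insert_min) (use insert 3 in auto)
        ultimately show ?thesis
          using False less_imp_neq[OF 3] insert.IH b
          by (simp add: wedge_smult_right insert_commute)
      qed
      finally show ?thesis .
    qed
  qed
qed

lemma wedge_mprod:
  assumes "A \<subseteq> I" "B \<subseteq> I"
  shows "wedge (mprod y A) (mprod y B) =
    (if A \<inter> B = {} then (\<lambda>S. shuffle_sign A B * mprod y (A \<union> B) S) else (\<lambda>_. 0))"
proof -
  have fB: "finite B" using assms fin finite_subset by auto
  have "finite A" using assms fin finite_subset by auto
  then show ?thesis using assms(1)
  proof (induction rule: finite_linorder_min_induct)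
    case empty
    then show ?case using wedge_one(1)[OF mprod_carrier fin(2)] assms by simp
  next
    case (insert a A)
    have a: "a \<in> I" "A \<subseteq> I" "finite A" "a \<notin> A" using insert by auto
    have "wedge (mprod y (insert a A)) (mprod y B) = wedge (y a) (wedge (mprod y A) (mprod y B))"
      using insert by (simp add: mprod_insert_min wedge_assoc)
    also have "\<dots> = (if insert a A \<inter> B = {}
        then (\<lambda>S. shuffle_sign (insert a A) B * mprod y (insert a A \<union> B) S) else (\<lambda>_. 0))"
    proof (cases "A \<inter> B = {}")
      case False
      then show ?thesis using insert.IH a by (auto simp: wedge_zero)
    next
      case True
      have "wedge (y a) (wedge (mprod y A) (mprod y B)) =
          (\<lambda>S. shuffle_sign A B * wedge (y a) (mprod y (A \<union> B)) S)"
        using insert.IH a True by (simp add: wedge_smult_right)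
      also have "\<dots> = (if a \<in> B then (\<lambda>_. 0)
          else (\<lambda>S. shuffle_sign A B * (shuffle_sign {a} (A \<union> B) * mprod y (insert a (A \<union> B)) S)))"
        using wedge_y_mprod[of a "A \<union> B"] a assms by auto
      also have "shuffle_sign {a} (A \<union> B) = shuffle_sign {a} B"
        using shuffle_sign_Un_right[of "{a}" A B] shuffle_sign_less[of "{a}" A] insert a fB True
        by simp
      also have "(\<lambda>S. shuffle_sign A B * (shuffle_sign {a} B * mprod y (insert a (A \<union> B)) S)) =
          (\<lambda>S. shuffle_sign (insert a A) B * mprod y (insert a A \<union> B) S)"
        using shuffle_sign_Un_left[of "{a}" A B] a fB by (simp add: mult_ac)
      finally show ?thesis using True by simp
    qed
    finally show ?case .
  qed
qed

lemma lift_mult: "lift I y (wedge f g) = wedge (lift I y f) (lift I y g)"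
proof
  fix R
  have finI: "finite A" if "A \<subseteq> I" for A using that fin finite_subset by blast
  have "wedge (lift I y f) (lift I y g) R =
      (\<Sum>A\<in>Pow I. \<Sum>B\<in>Pow I. f A * (g B * wedge (mprod y A) (mprod y B) R))"
    unfolding lift_def by (simp add: wedge_sum_left wedge_sum_right sum_distrib_left)
  also have "\<dots> = (\<Sum>A\<in>Pow I. \<Sum>B\<in>Pow (I - A). f A * (g B * (shuffle_sign A B * mprod y (A \<union> B) R)))"
  proof (rule sum.cong[OF refl])
    fix A assume A: "A \<in> Pow I"
    show "(\<Sum>B\<in>Pow I. f A * (g B * wedge (mprod y A) (mprod y B) R)) =
        (\<Sum>B\<in>Pow (I - A). f A * (g B * (shuffle_sign A B * mprod y (A \<union> B) R)))"
    proof (rule sum.mono_neutral_cong_right)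
      show "\<forall>B\<in>Pow I - Pow (I - A). f A * (g B * wedge (mprod y A) (mprod y B) R) = 0"
      proof
        fix B assume "B \<in> Pow I - Pow (I - A)"
        then have "B \<subseteq> I" "A \<inter> B \<noteq> {}" by auto
        then show "f A * (g B * wedge (mprod y A) (mprod y B) R) = 0"
          using A by (simp add: wedge_mprod)
      qed
      fix B assume "B \<in> Pow (I - A)"
      then have "B \<subseteq> I" "A \<inter> B = {}" by auto
      then show "f A * (g B * wedge (mprod y A) (mprod y B) R) =
          f A * (g B * (shuffle_sign A B * mprod y (A \<union> B) R))"
        using A by (simp add: wedge_mprod)
    qed (use fin in auto)
  qed
  also have "\<dots> = (\<Sum>(A, B)\<in>Sigma (Pow I) (\<lambda>A. Pow (I - A)).
      f A * (g B * (shuffle_sign A B * mprod y (A \<union> B) R)))"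
    by (rule sum.Sigma) (use fin in auto)
  also have "\<dots> = (\<Sum>(S, A)\<in>Sigma (Pow I) Pow.
      shuffle_sign A (S - A) * f A * g (S - A) * mprod y S R)"
  proof (rule sum.reindex_bij_witness[where i = "\<lambda>(C, A). (A, C - A)" and j = "\<lambda>(A, B). (A \<union> B, A)"])
    fix x assume "x \<in> Sigma (Pow I) (\<lambda>A. Pow (I - A))"
    then obtain A B where x: "x = (A, B)" "A \<inter> B = {}" by auto
    then have "A \<union> B - A = B" by auto
    with x show "(case case x of (A, B) \<Rightarrow> (A \<union> B, A) of (S, A) \<Rightarrow>
        shuffle_sign A (S - A) * f A * g (S - A) * mprod y S R) =
      (case x of (A, B) \<Rightarrow> f A * (g B * (shuffle_sign A B * mprod y (A \<union> B) R)))"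
      by simp
  qed auto
  also have "\<dots> = (\<Sum>S\<in>Pow I. \<Sum>A\<in>Pow S. shuffle_sign A (S - A) * f A * g (S - A) * mprod y S R)"
    by (rule sum.Sigma[symmetric]) (use fin finI in auto)
  also have "\<dots> = lift I y (wedge f g) R"
    by (simp add: lift_def wedge_def sum_distrib_right)
  finally show "lift I y (wedge f g) R = wedge (lift I y f) (lift I y g) R" ..
qed

lemma lift_monomial:
  assumes "S \<subseteq> I"
  shows "lift I y (monomial S) = mprod y S"
proof
  fix R
  have "lift I y (monomial S) R = (\<Sum>A\<in>Pow I. if A = S then mprod y S R else 0)"
    unfolding lift_def by (rule sum.cong) (auto simp: monomial_def)
  then show "lift I y (monomial S) R = mprod y S R"
    using fin assms by (simp add: sum.delta)
qed

lemma lift_carrier: "lift I y f \<in> carrier (exterior_algebra J)"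
proof -
  have "R \<subseteq> J" if "lift I y f R \<noteq> 0" for R
  proof -
    from that obtain S where "S \<in> Pow I" "f S * mprod y S R \<noteq> 0"
      unfolding lift_def by (rule sum.not_neutral_contains_not_neutral)
    then show ?thesis using mprod_carrier[of S] by (simp add: exterior_algebra_simps)
  qed
  then show ?thesis by (simp add: exterior_algebra_simps)
qed

lemma lift_hom: "lift I y \<in> algebra_hom class_ring (exterior_algebra I) (exterior_algebra J)"
proof -
  have one: "lift I y (monomial {}) = monomial {}"
    using lift_monomial[of "{}"] by simp
  have add: "lift I y (\<lambda>S. f S + g S) = (\<lambda>S. lift I y f S + lift I y g S)" for f g
    by (rule ext) (simp add: lift_def sum.distrib distrib_right)
  have sm: "lift I y (\<lambda>S. c * f S) = (\<lambda>S. c * lift I y f S)" for c f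
    by (rule ext) (simp add: lift_def sum_distrib_left mult.assoc)
  show ?thesis
    unfolding algebra_hom_def Ring.ring_hom_def LinearCombinations.module_hom_def
      exterior_algebra_simps(2-6)
    using lift_carrier by (simp add: one add sm lift_mult)
qed

lemma lift_gen:
  assumes "i \<in> I"
  shows "lift I y (monomial {i}) = y i"
proof -
  have "lift I y (monomial {i}) = mprod y {i}"
    by (rule lift_monomial) (use assms in blast)
  also have "\<dots> = wedge (y i) (monomial {})"
    by (simp add: mprod_def)
  also have "\<dots> = y i"
    by (rule wedge_one(2)[OF y_carrier[OF assms] fin(2)])
  finally show ?thesis .
qed

lemma hom_eq_lift:
  assumes h: "h \<in> algebra_hom class_ring (exterior_algebra I) (exterior_algebra J)"
    and gen: "\<And>i. i \<in> I \<Longrightarrow> h (monomial {i}) = y i"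
    and f: "f \<in> carrier (exterior_algebra I)"
  shows "h f = lift I y f"
proof -
  have mem: "monomial S \<in> carrier (exterior_algebra I)" if "S \<subseteq> I" for S
    using that by (simp add: exterior_algebra_simps monomial_def)
  have hmul: "h (wedge f g) = wedge (h f) (h g)"
    if "f \<in> carrier (exterior_algebra I)" "g \<in> carrier (exterior_algebra I)" for f g
    using h that by (simp add: algebra_hom_def Ring.ring_hom_def exterior_algebra_simps(2))
  have hadd: "h (\<lambda>S. f S + g S) = (\<lambda>S. h f S + h g S)"
    if "f \<in> carrier (exterior_algebra I)" "g \<in> carrier (exterior_algebra I)" for f g
    using h that by (simp add: algebra_hom_def Ring.ring_hom_def exterior_algebra_simps(5))
  have hsm: "h (\<lambda>S. c * f S) = (\<lambda>S. c * h f S)"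
    if "f \<in> carrier (exterior_algebra I)" for c f
    using h that
    by (simp add: algebra_hom_def LinearCombinations.module_hom_def exterior_algebra_simps(6))
  have mono: "h (monomial S) = mprod y S" if "S \<subseteq> I" for S
  proof -
    have "finite S" using that fin finite_subset by auto
    then show ?thesis using that
    proof (induction rule: finite_linorder_min_induct)
      case empty
      then show ?case
        using h by (simp add: algebra_hom_def Ring.ring_hom_def exterior_algebra_simps(3))
    next
      case (insert a A)
      have "shuffle_sign {a} A = 1" "a \<notin> A"
        using insert by (auto intro!: shuffle_sign_less)
      then have "wedge (monomial {a}) (monomial A) = monomial (insert a A)"
        using insert by (simp add: wedge_monomial)
      then show ?case
        using hmul[OF mem mem, of "{a}" A] insert gen[of a] by (simp add: mprod_insert_min)
    qed
  qed
  have part: "h (\<lambda>R. \<Sum>S\<in>X. f S * monomial S R) = (\<lambda>R. \<Sum>S\<in>X. f S * mprod y S R) \<and>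
      (\<lambda>R. \<Sum>S\<in>X. f S * monomial S R) \<in> carrier (exterior_algebra I)"
    if "finite X" "X \<subseteq> Pow I" for X
    using that
  proof (induction X)
    case empty
    have "h (\<lambda>_. 0) = (\<lambda>_. 0)" using hsm[OF f, of 0] by simp
    then show ?case by (simp add: exterior_algebra_simps)
  next
    case (insert S X)
    have c: "(\<lambda>R. f S * monomial S R) \<in> carrier (exterior_algebra I)"
      using mem[of S] insert.prems by (simp add: exterior_algebra_simps)
    have IH: "(\<lambda>R. \<Sum>S\<in>X. f S * monomial S R) \<in> carrier (exterior_algebra I)"
      "h (\<lambda>R. \<Sum>S\<in>X. f S * monomial S R) = (\<lambda>R. \<Sum>S\<in>X. f S * mprod y S R)"
      using insert by auto
    have split: "(\<lambda>R. \<Sum>S\<in>insert S X. f S * F S R) =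
        (\<lambda>R. f S * F S R + (\<Sum>S\<in>X. f S * F S R))" for F :: "'i set \<Rightarrow> 'k \<Rightarrow> complex"
      using insert.hyps by simp
    have cl: "(\<lambda>R. u R + v R) \<in> carrier (exterior_algebra I)"
      if "u \<in> carrier (exterior_algebra I)" "v \<in> carrier (exterior_algebra I)" for u v
      using that unfolding exterior_algebra_simps(1) mem_Collect_eq by (metis add.left_neutral)
    have S: "S \<subseteq> I" using insert.prems by auto
    have "h (\<lambda>R. \<Sum>S\<in>insert S X. f S * monomial S R) =
        (\<lambda>R. \<Sum>S\<in>insert S X. f S * mprod y S R)"
      unfolding split hadd[OF c IH(1)] hsm[OF mem[OF S]] mono[OF S] IH(2) ..
    moreover have "(\<lambda>R. \<Sum>S\<in>insert S X. f S * monomial S R) \<in> carrier (exterior_algebra I)"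
      unfolding split by (rule cl[OF c IH(1)])
    ultimately show ?case ..
  qed
  have "f = (\<lambda>R. \<Sum>S\<in>Pow I. f S * monomial S R)"
  proof
    fix R
    have "(\<Sum>S\<in>Pow I. f S * monomial S R) = (\<Sum>S\<in>Pow I. if S = R then f S else 0)"
      by (rule sum.cong) (auto simp: monomial_def)
    also have "\<dots> = (if R \<in> Pow I then f R else 0)"
      by (rule sum.delta) (simp add: fin)
    also have "\<dots> = f R" using f by (simp add: exterior_algebra_simps) blast
    finally show "f R = (\<Sum>S\<in>Pow I. f S * monomial S R)" ..
  qed
  then show ?thesis using part[of "Pow I"] fin unfolding lift_def by simp
qed

end

lemma shift_hom:
  fixes n :: nat
  defines "shift \<equiv> \<lambda>T. T \<in> algebra_hom class_ring (E n) (E n) \<and>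
    (\<forall>i\<in>{1..n}. T (theta n i) = theta n i \<oplus>\<^bsub>E n\<^esub> alpha i \<and> T (alpha i) = alpha i)"
  shows shift_hom_exists: "\<exists>T. shift T"
    and shift_hom_unique: "shift T \<Longrightarrow> shift T' \<Longrightarrow> f \<in> carrier (E n) \<Longrightarrow> T f = T' f"
proof -
  let ?I = "{1..2 * n}"
  define y :: "nat \<Rightarrow> nat set \<Rightarrow> complex" where
    "y k = (if k \<le> n then monomial {k} else (\<lambda>S. monomial {k} S + monomial {k - n} S))" for k
  have yc: "y i \<in> carrier (exterior_algebra ?I)" if "i \<in> ?I" for i
  proof -
    have m: "monomial {k} S = 0" if "k \<in> ?I" "\<not> S \<subseteq> ?I" for k S
    proof -
      have "S \<noteq> {k}" using that by blast
      then show ?thesis by (simp add: monomial_def)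
    qed
    have "i - n \<in> ?I" if "\<not> i \<le> n"
      using that \<open>i \<in> ?I\<close> by (simp only: atLeastAtMost_iff) linarith
    then have "y i S = 0" if "\<not> S \<subseteq> ?I" for S
      using m[OF \<open>i \<in> ?I\<close> that] m[of "i - n", OF _ that] by (simp only: y_def split: if_split) simp
    then show ?thesis
      unfolding exterior_algebra_simps(1) by blast
  qed
  have ya: "wedge (y i) (y j) = (\<lambda>S. - wedge (y j) (y i) S)" for i j
  proof
    fix S
    have a: "wedge (monomial {k}) (monomial {l}) S = - wedge (monomial {l}) (monomial {k}) S" for k l :: nat
      using wedge_gen_anticommute[of k l] by metis
    show "wedge (y i) (y j) S = - wedge (y j) (y i) S"
      using a[of i j] a[of i "j - n"] a[of "i - n" j] a[of "i - n" "j - n"]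
      by (simp add: y_def wedge_add_left wedge_add_right)
  qed
  have fin: "finite ?I" by simp
  have hom: "lift ?I y \<in> algebra_hom class_ring (exterior_algebra ?I) (exterior_algebra ?I)"
    by (rule lift_hom[OF fin fin]; (erule yc | rule ya))
  have gen: "lift ?I y (monomial {i}) = y i" if "i \<in> ?I" for i
    by (rule lift_gen[OF fin fin _ _ that]; (erule yc | rule ya))
  have eq: "h f = lift ?I y f"
    if "h \<in> algebra_hom class_ring (exterior_algebra ?I) (exterior_algebra ?I)"
      and "\<And>i. i \<in> ?I \<Longrightarrow> h (monomial {i}) = y i" and "f \<in> carrier (exterior_algebra ?I)" for h f
    by (rule hom_eq_lift[OF fin fin _ _ that(1) _ that(3)]; (erule yc | erule that(2) | rule ya))
  have iff: "shift T \<longleftrightarrow> T \<in> algebra_hom class_ring (exterior_algebra ?I) (exterior_algebra ?I) \<and>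
      (\<forall>k\<in>?I. T (monomial {k}) = y k)" for T
  proof -
    have I: "?I = {1..n} \<union> (+) n ` {1..n}"
      by (simp add: image_add_atLeastAtMost) auto
    have "(\<forall>k\<in>?I. T (monomial {k}) = y k) \<longleftrightarrow>
        (\<forall>i\<in>{1..n}. T (monomial {i}) = y i \<and> T (monomial {n + i}) = y (n + i))"
      unfolding I ball_Un ball_simps by blast
    then show ?thesis
      by (auto simp: shift_def E_def alpha_def theta_def y_def exterior_algebra_simps(5))
  qed
  show "\<exists>T. shift T"
    unfolding iff by (intro exI[of _ "lift ?I y"] conjI ballI hom gen)
  show "T f = T' f" if T: "shift T" "shift T'" and f: "f \<in> carrier (E n)"
  proof -
    have f': "f \<in> carrier (exterior_algebra ?I)"
      using f unfolding E_def .
    have "T f = lift ?I y f"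
      by (rule eq[OF _ _ f']) (use T(1) iff in blast)+
    moreover have "T' f = lift ?I y f"
      by (rule eq[OF _ _ f']) (use T(2) iff in blast)+
    ultimately show ?thesis by simp
  qed
qed

end

theory Submission
  imports Defs "HOL-Library.Function_Algebras"
begin

text \<open>
  Write \<open>\<langle>f, g\<rangle>\<close> for the top coefficient of \<open>f g\<close>; this form on \<open>E\<^sub>n\<close> is nondegenerate. As \<open>T\<close> is
  multiplicative and unitriangular in the monomial basis, it preserves the top coefficient, hence
  \<open>\<langle>T f, T g\<rangle> = \<langle>f, g\<rangle>\<close>. So invariants are orthogonal to coboundaries. Conversely, anything outside
  the space of coboundaries is separated from it by a functional \<open>\<langle>f, -\<rangle>\<close>, and
  \<open>\<langle>T f - f, T h\<rangle> = \<langle>f, h\<rangle> - \<langle>f, T h\<rangle> = 0\<close> for all \<open>h\<close> forces \<open>T f = f\<close> because \<open>T\<close> is surjective.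
\<close>

section \<open>Linear algebra\<close>

text \<open>Adjoining \<open>g\<close> to a basis of \<open>U\<close> keeps it independent, so a
  linear functional with value 1 at \<open>g\<close> and 0 on \<open>U\<close> exists. As all
  supports lie in the finite set \<open>I\<close>, it is given by coefficients \<open>c\<close>, the
  form that \<open>functional_eq_wedge\<close> turns into a product.\<close>

lemma exists_separating_functional:
  fixes U :: "('a \<Rightarrow> 'k::field) set"
  assumes "finite I"
    and supp: "\<And>f x. f \<in> insert g U \<Longrightarrow> f x \<noteq> 0 \<Longrightarrow> x \<in> I"
    and zero: "(\<lambda>_. 0) \<in> U"
    and add: "\<And>u v. u \<in> U \<Longrightarrow> v \<in> U \<Longrightarrow> (\<lambda>x. u x + v x) \<in> U"
    and scale: "\<And>c u. u \<in> U \<Longrightarrow> (\<lambda>x. c * u x) \<in> U"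
    and "g \<notin> U"
  shows "\<exists>c. (\<Sum>x\<in>I. c x * g x) \<noteq> 0 \<and> (\<forall>u\<in>U. (\<Sum>x\<in>I. c x * u x) = 0)"
proof -
  \<comment> \<open>Pointwise scaling turns the whole function type into a vector space;
    \<open>U\<close> is a subspace of it.\<close>
  define s where "s = (\<lambda>(c::'k) (f::'a \<Rightarrow> 'k) x. c * f x)"
  interpret vector_space_pair s "(*) :: 'k \<Rightarrow> 'k \<Rightarrow> 'k"
    by unfold_locales (auto simp: s_def fun_eq_iff algebra_simps)
  have sub: "vs1.subspace U"
    using zero add scale unfolding vs1.subspace_def
    by (auto simp: s_def zero_fun_def plus_fun_def)
  obtain B where B: "B \<subseteq> U" "vs1.independent B" "U \<subseteq> vs1.span B"
    using vs1.maximal_independent_subset by blast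
  have span: "vs1.span B \<subseteq> U"
    using vs1.span_minimal[OF B(1) sub] .
  have "vs1.independent (insert g B)"
    using vs1.independent_insertI[OF _ B(2)] span \<open>g \<notin> U\<close> by blast
  from linear_independent_extend[OF this, of "\<lambda>x. if x = g then 1 else 0"]
  obtain \<phi> where \<phi>: "Vector_Spaces.linear s (*) \<phi>"
    and \<phi>B: "\<And>x. x \<in> insert g B \<Longrightarrow> \<phi> x = (if x = g then 1 else 0)"
    by blast
  have \<phi>U: "\<phi> u = 0" if "u \<in> U" for u
    by (rule linear_eq_0_on_span[OF \<phi>, of B])
      (use \<phi>B B(1,3) \<open>g \<notin> U\<close> that in auto)
  \<comment> \<open>The coordinate vectors; the coefficients sought are the values of
    \<open>\<phi>\<close> on them.\<close>
  define e where "e = (\<lambda>(x::'a) y. if y = x then 1 else 0 :: 'k)"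
  have repr: "\<phi> f = (\<Sum>x\<in>I. \<phi> (e x) * f x)" if "f \<in> insert g U" for f
  proof -
    have "f = (\<Sum>x\<in>I. s (f x) (e x))"
    proof
      fix y
      have "(\<Sum>x\<in>I. s (f x) (e x)) y = (\<Sum>x\<in>I. s (f x) (e x) y)"
        by (induction I rule: infinite_finite_induct) auto
      also have "\<dots> = (\<Sum>x\<in>I. if y = x then f x else 0)"
        by (simp add: s_def e_def if_distrib cong: if_cong)
      finally have "(\<Sum>x\<in>I. s (f x) (e x)) y = (\<Sum>x\<in>I. if y = x then f x else 0)" .
      then show "f y = (\<Sum>x\<in>I. s (f x) (e x)) y"
        using supp[OF that, of y] assms(1) by auto
    qed
    then have "\<phi> f = (\<Sum>x\<in>I. \<phi> (s (f x) (e x)))"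
      using linear_sum[OF \<phi>, of "\<lambda>x. s (f x) (e x)" I] by metis
    then show ?thesis
      by (simp add: linear_scale[OF \<phi>] mult.commute)
  qed
  have "\<phi> g \<noteq> 0" using \<phi>B by simp
  then show ?thesis
    using repr \<phi>U by (intro exI[of _ "\<lambda>x. \<phi> (e x)"]) fastforce
qed

text \<open>Independence in \<open>W\<close> agrees with independence in \<open>V\<close>, so
  independent subsets of \<open>W\<close> have at most \<open>dim\<close> elements. A maximal one,
  reached from the empty set, is a basis of \<open>W\<close>.\<close>

lemma (in vectorspace) fin_dim_subspace:
  assumes "fin_dim" "subspace K W V"
  shows "vectorspace.fin_dim K (vs W)"
proof -
  interpret W: vectorspace K "vs W"
    by (rule subspace_is_vs[OF assms(2)])
  have sm: "submodule K W V" using assms(2) by (simp add: subspace_def)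
  then have WV: "W \<subseteq> carrier V" by (rule submodule.subset)
  have "W.lin_dep S = lin_dep S" if "S \<subseteq> W" for S
    by (rule span_li_not_depend(2)[OF that sm])
  then have "finite S \<and> card S \<le> dim" if "S \<subseteq> carrier (vs W) \<and> W.lin_indpt S" for S
    using li_le_dim[OF assms(1), of S] that WV by auto
  moreover have "{} \<subseteq> carrier (vs W) \<and> W.lin_indpt {}"
    by (auto simp: W.lin_dep_def)
  ultimately obtain A where "finite A" "maximal A (\<lambda>S. S \<subseteq> carrier (vs W) \<and> W.lin_indpt S)"
    using maximal_exists[of "\<lambda>S. S \<subseteq> carrier (vs W) \<and> W.lin_indpt S" dim "{}"] by blast
  then show ?thesis
    using W.max_li_is_basis unfolding W.basis_def W.fin_dim_def by blast
qed

section \<open>Cosets of a subspace and quotient vector spaces\<close>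

context subspace
begin

interpretation V: vectorspace K V by (rule vs)
interpretation S: submodule K W V by (rule submod)

lemma abelian_subgroup: "abelian_subgroup W V"
proof (rule abelian_subgroupI3[OF additive_subgroupI])
  show "subgroup W (add_monoid V)"
  proof (rule V.add.subgroupI)
    fix a assume a: "a \<in> W"
    \<comment> \<open>Negation is scaling by -1, so closure under scaling gives additive
      inverses.\<close>
    then have "(\<ominus>\<^bsub>K\<^esub> \<one>\<^bsub>K\<^esub>) \<odot> a \<in> W" by simp
    moreover have "(\<ominus>\<^bsub>K\<^esub> \<one>\<^bsub>K\<^esub>) \<odot> a = \<ominus> a"
      using a S.subset by (intro V.smult_minus_1) auto
    ultimately show "\<ominus> a \<in> W" by simp
  qed (use S.subset S.zero_closed in \<open>auto simp del: S.zero_closed\<close>)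
qed (rule V.abelian_group_axioms)

interpretation A: abelian_subgroup W V by (rule abelian_subgroup)

lemma rcos_eq_iff:
  assumes "x \<in> carrier V" "y \<in> carrier V"
  shows "W +> x = W +> y \<longleftrightarrow> x \<ominus> y \<in> W"
  using assms A.a_rcos_module[of y x] A.a_repr_independence'[of x y] A.a_rcos_self[of x]
  by (auto simp: a_minus_def)

text \<open>Scaling in the quotient is well defined: representatives \<open>w \<oplus> x\<close> and
  \<open>x\<close> give multiples that differ by \<open>c \<odot> w \<in> W\<close>, so every coset
  in the union is the same one.\<close>

lemma rcos_smult:
  assumes "c \<in> carrier K" "x \<in> carrier V"
  shows "(\<Union>y\<in>W +> x. W +> (c \<odot> y)) = W +> (c \<odot> x)"
proof -
  have "W +> (c \<odot> y) = W +> (c \<odot> x)" if "y \<in> W +> x" for y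
  proof -
    from that obtain w where w: "w \<in> W" "y = w \<oplus> x" by (auto simp: a_r_coset_def')
    then have "c \<odot> y = c \<odot> w \<oplus> c \<odot> x"
      using assms S.subset by (auto simp: V.smult_r_distr)
    then have "c \<odot> y \<in> W +> (c \<odot> x)"
      using w assms by (auto simp: a_r_coset_def')
    then show ?thesis
      using A.a_repr_independence' assms(1,2) by (metis V.smult_closed)
  qed
  \<comment> \<open>This makes the index set of the union nonempty, so that the union is that common
    coset and not the empty set.\<close>
  moreover have "x \<in> W +> x" using assms(2) by (rule A.a_rcos_self)
  ultimately show ?thesis by blast
qed

end

context
  fixes K :: "('k, 'c) ring_scheme" and V :: "('k, 'a) module" and U :: "'a set"
  assumes sub: "subspace K U V"
begin

interpretation V: vectorspace K V by (rule subspace.vs[OF sub])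
interpretation A: abelian_subgroup U V by (rule subspace.abelian_subgroup[OF sub])

text \<open>In terms of representatives, each vector space axiom of the quotient reduces to the same
  axiom of \<open>V\<close>.\<close>

lemma quotient_space_simps:
  "carrier (quotient_space V U) = (\<lambda>x. U +>\<^bsub>V\<^esub> x) ` carrier V"
  "zero (quotient_space V U) = U +>\<^bsub>V\<^esub> \<zero>\<^bsub>V\<^esub>"
  "\<lbrakk>x \<in> carrier V; y \<in> carrier V\<rbrakk> \<Longrightarrow>
    add (quotient_space V U) (U +>\<^bsub>V\<^esub> x) (U +>\<^bsub>V\<^esub> y) = U +>\<^bsub>V\<^esub> (x \<oplus>\<^bsub>V\<^esub> y)"
  "\<lbrakk>c \<in> carrier K; x \<in> carrier V\<rbrakk> \<Longrightarrow>
    module.smult (quotient_space V U) c (U +>\<^bsub>V\<^esub> x) = U +>\<^bsub>V\<^esub> (c \<odot>\<^bsub>V\<^esub> x)"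
  by (auto simp: quotient_space_def A_RCOSETS_def' A.a_rcos_sum subspace.rcos_smult[OF sub] A.a_subset)

lemma quotient_space_vectorspace: "vectorspace K (quotient_space V U)" (is "vectorspace K ?Q")
proof (rule vs_criteria)
  show "\<forall>v\<in>carrier (quotient_space V U). \<exists>w\<in>carrier (quotient_space V U).
      v \<oplus>\<^bsub>quotient_space V U\<^esub> w = \<zero>\<^bsub>quotient_space V U\<^esub>"
  proof
    fix v assume "v \<in> carrier (quotient_space V U)"
    then obtain x where "x \<in> carrier V" "v = U +>\<^bsub>V\<^esub> x" by (auto simp: quotient_space_simps)
    then show "\<exists>w\<in>carrier (quotient_space V U). v \<oplus>\<^bsub>quotient_space V U\<^esub> w = \<zero>\<^bsub>quotient_space V U\<^esub>"
      by (intro bexI[of _ "U +>\<^bsub>V\<^esub> (\<ominus>\<^bsub>V\<^esub> x)"]) (auto simp: quotient_space_simps V.r_neg)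
  qed
  show "field K" by (rule V.field_axioms)
  show "\<forall>v w. v \<in> carrier ?Q \<and> w \<in> carrier ?Q \<longrightarrow> v \<oplus>\<^bsub>?Q\<^esub> w = w \<oplus>\<^bsub>?Q\<^esub> v"
    by (auto simp: quotient_space_simps V.a_comm)
qed (auto simp: quotient_space_simps V.a_assoc V.smult_assoc1 V.smult_l_distr V.smult_r_distr)

text \<open>The projection is onto, so it carries finite dimension from \<open>V\<close> to the
  quotient.\<close>

lemma quotient_space_proj: "linear_map K V (quotient_space V U) (\<lambda>x. U +>\<^bsub>V\<^esub> x)"
proof -
  interpret Q: vectorspace K "quotient_space V U" by (rule quotient_space_vectorspace)
  show ?thesis
    by unfold_locales (auto simp: LinearCombinations.module_hom_def quotient_space_simps)
qed

lemma quotient_space_fin_dim: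
  assumes "V.fin_dim"
  shows "vectorspace.fin_dim K (quotient_space V U)"
  by (rule linear_map.surj_fin_dim[OF quotient_space_proj assms]) (simp add: quotient_space_simps)

end

section \<open>The exterior algebra\<close>

text \<open>An element has finitely many coefficients when \<open>I\<close> is finite, so it is
  rebuilt from 0 one monomial at a time. This extends facts about monomials to all elements by
  linearity.\<close>

lemma exterior_algebra_induct [consumes 2, case_names zero add]:
  assumes "finite I" "f \<in> carrier (exterior_algebra I)"
    and zero: "P (\<lambda>_. 0)"
    and add: "\<And>S c f. \<lbrakk>S \<subseteq> I; f \<in> carrier (exterior_algebra I); P f\<rbrakk> \<Longrightarrow>
      P (\<lambda>R. c * monomial S R + f R)"
  shows "P f"
proof -
  have part: "P (\<lambda>R. if R \<in> X then f R else 0)" if "finite X" for X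
    using that
  proof (induction X)
    case (insert S X)
    let ?g = "\<lambda>R. if R \<in> X then f R else 0"
    show ?case
    proof (cases "S \<subseteq> I")
      case True
      have "(\<lambda>R. if R \<in> insert S X then f R else 0) = (\<lambda>R. f S * monomial S R + ?g R)"
        using insert.hyps by (auto simp: monomial_def)
      moreover have "?g \<in> carrier (exterior_algebra I)"
        using assms(2) by (simp add: exterior_algebra_simps)
      ultimately show ?thesis
        using add[OF True _ insert.IH] by simp
    next
      case False
      \<comment> \<open>Coefficients of \<open>f\<close> outside \<open>Pow I\<close> vanish, so
        admitting \<open>S\<close> changes nothing.\<close>
      then have "(\<lambda>R. if R \<in> insert S X then f R else 0) = ?g"
        using assms(2) by (intro ext) (auto simp: exterior_algebra_simps)
      then show ?thesis using insert.IH by simp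
    qed
  qed (simp add: zero)
  have "f = (\<lambda>R. if R \<in> Pow I then f R else 0)"
    using assms(2) by (intro ext) (auto simp: exterior_algebra_simps)
  with part[of "Pow I"] assms(1) show ?thesis by simp
qed

lemma monomial_carrier: "monomial S \<in> carrier (exterior_algebra I) \<longleftrightarrow> S \<subseteq> I"
  by (auto simp: exterior_algebra_simps monomial_def)

text \<open>The finitely many monomials span, by induction on the element.\<close>

lemma exterior_algebra_fin_dim:
  assumes "finite I"
  shows "vectorspace.fin_dim class_ring (exterior_algebra I)"
proof -
  interpret vectorspace class_ring "exterior_algebra I"
    by (rule exterior_algebra_vectorspace)
  let ?B = "monomial ` Pow I"
  have B: "?B \<subseteq> carrier (exterior_algebra I)"
    by (auto simp: monomial_carrier)
  interpret span: submodule class_ring "span ?B" "exterior_algebra I"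
    by (rule span_is_submodule[OF B])
  have "f \<in> span ?B" if "f \<in> carrier (exterior_algebra I)" for f
    using assms that
  proof (induction rule: exterior_algebra_induct)
    case zero
    then show ?case using span.zero_closed by (simp add: exterior_algebra_simps)
  next
    case (add S c f)
    have "monomial S \<in> span ?B"
      using in_own_span[OF B] add(1) by blast
    then show ?case
      using span.m_closed[OF span.smult_closed[of c] add(3), of "monomial S"]
      by (simp add: exterior_algebra_simps)
  qed
  then have "gen_set ?B"
    using span_is_subset2[OF B] by blast
  then show ?thesis
    using B assms unfolding fin_dim_def by (intro exI[of _ ?B]) simp
qed

lemma wedge_minus_left: "wedge (\<lambda>S. f S - g S) h = (\<lambda>S. wedge f h S - wedge g h S)"
  using wedge_add_left[of f "\<lambda>S. - 1 * g S" h] unfolding wedge_smult_left by simp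

lemma wedge_minus_right: "wedge h (\<lambda>S. f S - g S) = (\<lambda>S. wedge h f S - wedge h g S)"
  using wedge_add_right[of h f "\<lambda>S. - 1 * g S"] unfolding wedge_smult_right by simp

context
  fixes I :: "'i::linorder set"
begin

interpretation V: vectorspace class_ring "exterior_algebra I"
  by (rule exterior_algebra_vectorspace)

lemma zero_carrier: "(\<lambda>_. 0) \<in> carrier (exterior_algebra I)"
  by (simp add: exterior_algebra_simps)

lemma add_carrier: "\<lbrakk>f \<in> carrier (exterior_algebra I); g \<in> carrier (exterior_algebra I)\<rbrakk> \<Longrightarrow>
    (\<lambda>S. f S + g S) \<in> carrier (exterior_algebra I)"
  using V.a_closed[of f g] by (simp add: exterior_algebra_simps(5))

lemma smult_carrier: "f \<in> carrier (exterior_algebra I) \<Longrightarrow>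
    (\<lambda>S. c * f S) \<in> carrier (exterior_algebra I)"
  using V.smult_closed[of c f] by (simp add: exterior_algebra_simps(6))

lemma exterior_algebra_minus_eq: "g \<in> carrier (exterior_algebra I) \<Longrightarrow>
    f \<ominus>\<^bsub>exterior_algebra I\<^esub> g = (\<lambda>S. f S - g S)"
  using V.smult_minus_1[of g]
  by (simp add: a_minus_def exterior_algebra_simps(5,6) class_ring_simps fun_eq_iff flip: diff_conv_add_uminus)

lemma minus_carrier: "\<lbrakk>f \<in> carrier (exterior_algebra I); g \<in> carrier (exterior_algebra I)\<rbrakk> \<Longrightarrow>
    (\<lambda>S. f S - g S) \<in> carrier (exterior_algebra I)"
  using add_carrier[OF _ smult_carrier[of g "-1"], of f] by simp

end

text \<open>Multiplying by a generator below all the others creates no inversion. Inductions that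
  add generators in decreasing order therefore meet no signs.\<close>

lemma monomial_insert_min:
  fixes a :: "'i::linorder"
  assumes "finite A" "\<forall>x\<in>A. a < x"
  shows "monomial (insert a A) = wedge (monomial {a}) (monomial A)" "shuffle_sign {a} A = 1"
proof -
  show sgn: "shuffle_sign {a} A = 1"
    by (rule shuffle_sign_less) (use assms in auto)
  have "a \<notin> A" using assms by auto
  then show "monomial (insert a A) = wedge (monomial {a}) (monomial A)"
    using assms by (simp add: wedge_monomial sgn)
qed

text \<open>If \<open>f A\<close> is nonzero, the complementary monomial
  \<open>monomial (I - A)\<close> isolates it: the top coefficient of the product is
  \<open>f A\<close> up to sign.\<close>

lemma wedge_nondegenerate:
  assumes "finite I" "f \<in> carrier (exterior_algebra I)" "f \<noteq> (\<lambda>_. 0)"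
  shows "\<exists>g\<in>carrier (exterior_algebra I). wedge f g I \<noteq> 0"
proof -
  obtain A where A: "f A \<noteq> 0" using assms(3) by auto
  then have "A \<subseteq> I" using assms(2) by (auto simp: exterior_algebra_simps)
  have "wedge f (monomial (I - A)) I = (\<Sum>B\<in>Pow I. if B = A then shuffle_sign A (I - A) * f A else 0)"
    unfolding wedge_def
  proof (rule sum.cong[OF refl])
    fix B assume "B \<in> Pow I"
    then have "I - B = I - A \<longleftrightarrow> B = A" using \<open>A \<subseteq> I\<close> by blast
    then show "shuffle_sign B (I - B) * f B * monomial (I - A) (I - B) =
        (if B = A then shuffle_sign A (I - A) * f A else 0)"
      by (auto simp: monomial_def)
  qed
  then have "wedge f (monomial (I - A)) I \<noteq> 0"
    using A \<open>A \<subseteq> I\<close> \<open>finite I\<close> by (simp add: shuffle_sign_def)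
  then show ?thesis
    by (intro bexI[of _ "monomial (I - A)"]) (auto simp: monomial_carrier)
qed

text \<open>The top-coefficient form represents every coefficient functional. The coefficient of
  \<open>f\<close> at \<open>A\<close> is that of the functional at the complement, corrected by the
  shuffle sign, whose square is 1.\<close>

lemma functional_eq_wedge:
  fixes I :: "'i::linorder set"
  shows "\<exists>f\<in>carrier (exterior_algebra I). \<forall>g. wedge f g I = (\<Sum>S\<in>Pow I. c S * g S)"
proof -
  define f where "f = (\<lambda>A. if A \<subseteq> I then shuffle_sign A (I - A) * c (I - A) else 0)"
  have sq: "shuffle_sign A B * shuffle_sign A B = 1" for A B :: "'i set"
    by (simp add: shuffle_sign_def flip: power_mult_distrib)
  have "wedge f g I = (\<Sum>S\<in>Pow I. c S * g S)" for g
  proof -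
    have "wedge f g I = (\<Sum>A\<in>Pow I. c (I - A) * g (I - A))"
      unfolding wedge_def f_def
      by (rule sum.cong) (simp_all add: sq flip: mult.assoc)
    also have "\<dots> = (\<Sum>S\<in>Pow I. c S * g S)"
      by (rule sum.reindex_bij_witness[of _ "\<lambda>A. I - A" "\<lambda>A. I - A"]) (auto simp: double_diff)
    finally show ?thesis .
  qed
  moreover have "f \<in> carrier (exterior_algebra I)"
    by (simp add: f_def exterior_algebra_simps(1))
  ultimately show ?thesis by blast
qed

text \<open>For subsets of \<open>{1..2 * n}\<close>, replacing \<open>\<theta>\<^sub>i\<close> by \<open>\<alpha>\<^sub>i\<close> lowers the sum of the generator numbers,
  and the full set is the only one of largest sum.\<close>

definition leading_monomial :: "nat set \<Rightarrow> (nat set \<Rightarrow> complex) \<Rightarrow> bool" where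
  "leading_monomial A f \<longleftrightarrow> f A = 1 \<and> (\<forall>R. f R \<noteq> 0 \<longrightarrow> R = A \<or> \<Sum>R < \<Sum>A)"

text \<open>Generator sums add over a disjoint splitting, so a non-leading term in either factor
  makes the total strictly smaller. Only the product of the two leading terms reaches
  \<open>A \<union> B\<close>, with sign 1.\<close>

lemma leading_monomial_wedge:
  assumes "leading_monomial A f" "leading_monomial B g" "finite A" "finite B" "A \<inter> B = {}"
    and "shuffle_sign A B = 1"
  shows "leading_monomial (A \<union> B) (wedge f g)"
proof -
  have factors: "C = A \<and> R - C = B \<or> \<Sum>R < \<Sum>(A \<union> B)"
    if "finite R" "C \<subseteq> R" "f C \<noteq> 0" "g (R - C) \<noteq> 0" for R C
  proof -
    have "\<Sum>R = \<Sum>C + \<Sum>(R - C)"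
      using that(1,2) by (metis sum.subset_diff add.commute)
    moreover have "\<Sum>(A \<union> B) = \<Sum>A + \<Sum>B"
      using assms by (intro sum.union_disjoint) auto
    moreover have "C = A \<or> \<Sum>C < \<Sum>A" "R - C = B \<or> \<Sum>(R - C) < \<Sum>B"
      using assms(1,2) that(3,4) by (auto simp: leading_monomial_def)
    ultimately show ?thesis by auto
  qed
  have "wedge f g (A \<union> B) = 1"
  proof -
    have "wedge f g (A \<union> B) = (\<Sum>C\<in>Pow (A \<union> B). if C = A then 1 else 0)"
      unfolding wedge_def
    proof (rule sum.cong[OF refl])
      fix C assume C: "C \<in> Pow (A \<union> B)"
      have "A \<union> B - A = B" using assms(5) by auto
      \<comment> \<open>For \<open>C \<noteq> A\<close> with both coefficients nonzero,
        \<open>factors\<close> would make the sum of \<open>A \<union> B\<close> smaller than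
        itself.\<close>
      then show "shuffle_sign C (A \<union> B - C) * f C * g (A \<union> B - C) = (if C = A then 1 else 0)"
        using factors[of "A \<union> B" C] C assms by (auto simp: leading_monomial_def)
    qed
    then show ?thesis using assms(3,4) by (simp add: sum.delta)
  qed
  moreover have "R = A \<union> B \<or> \<Sum>R < \<Sum>(A \<union> B)" if "wedge f g R \<noteq> 0" for R
  proof -
    have "finite R" using that wedge_infinite by blast
    from that obtain C where "C \<in> Pow R" "shuffle_sign C (R - C) * f C * g (R - C) \<noteq> 0"
      unfolding wedge_def by (rule sum.not_neutral_contains_not_neutral)
    then show ?thesis using factors[OF \<open>finite R\<close>, of C] by auto
  qed
  ultimately show ?thesis by (simp add: leading_monomial_def)
qed

section \<open>The shift endomorphism: triangularity, invariance of the form, surjectivity\<close>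

locale shift_endomorphism =
  fixes n :: nat and T :: "(nat set \<Rightarrow> complex) \<Rightarrow> nat set \<Rightarrow> complex"
  assumes hom: "T \<in> algebra_hom class_ring (E n) (E n)"
    and T_theta: "i \<in> {1..n} \<Longrightarrow> T (theta n i) = theta n i \<oplus>\<^bsub>E n\<^esub> alpha i"
    and T_alpha: "i \<in> {1..n} \<Longrightarrow> T (alpha i) = alpha i"
begin

declare One_nat_def [simp del]

abbreviation I :: "nat set" where "I \<equiv> {1..2 * n}"

sublocale V: vectorspace class_ring "exterior_algebra I"
  by (rule exterior_algebra_vectorspace)

lemma T_closed: "f \<in> carrier (exterior_algebra I) \<Longrightarrow> T f \<in> carrier (exterior_algebra I)"
  using hom by (auto simp: algebra_hom_def Ring.ring_hom_def E_def)

lemma T_wedge: "\<lbrakk>f \<in> carrier (exterior_algebra I); g \<in> carrier (exterior_algebra I)\<rbrakk> \<Longrightarrow>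
    T (wedge f g) = wedge (T f) (T g)"
  using hom by (simp add: algebra_hom_def Ring.ring_hom_def E_def exterior_algebra_simps(2))

lemma T_add: "\<lbrakk>f \<in> carrier (exterior_algebra I); g \<in> carrier (exterior_algebra I)\<rbrakk> \<Longrightarrow>
    T (\<lambda>S. f S + g S) = (\<lambda>S. T f S + T g S)"
  using hom by (simp add: algebra_hom_def Ring.ring_hom_def E_def exterior_algebra_simps(5))

lemma T_smult: "f \<in> carrier (exterior_algebra I) \<Longrightarrow> T (\<lambda>S. c * f S) = (\<lambda>S. c * T f S)"
  using hom
  by (simp add: algebra_hom_def LinearCombinations.module_hom_def E_def exterior_algebra_simps(6))

lemma T_one: "T (monomial {}) = monomial {}"
  using hom by (simp add: algebra_hom_def Ring.ring_hom_def E_def exterior_algebra_simps(3))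

lemma T_zero: "T (\<lambda>_. 0) = (\<lambda>_. 0)"
  using T_smult[OF zero_carrier, of 0] by simp

lemma T_minus: "\<lbrakk>f \<in> carrier (exterior_algebra I); g \<in> carrier (exterior_algebra I)\<rbrakk> \<Longrightarrow>
    T (\<lambda>S. f S - g S) = (\<lambda>S. T f S - T g S)"
  using T_add[OF _ smult_carrier[where f = g and c = "-1"], of f] by (simp add: T_smult[where c = "-1", simplified])

lemma generator_cases:
  assumes "k \<in> I"
  obtains "k \<in> {1..n}" | i where "i \<in> {1..n}" "k = n + i"
proof (cases "k \<le> n")
  case False
  then have "k - n \<in> {1..n}" "k = n + (k - n)" using assms by auto
  then show ?thesis using that(2) by blast
qed (use assms that(1) in auto)

lemma T_gen_alpha: "i \<in> {1..n} \<Longrightarrow> T (monomial {i}) = monomial {i}"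
  using T_alpha by (simp add: alpha_def)

lemma T_gen_theta: "i \<in> {1..n} \<Longrightarrow> T (monomial {n + i}) = (\<lambda>S. monomial {n + i} S + monomial {i} S)"
  using T_theta by (simp add: theta_def alpha_def E_def exterior_algebra_simps)

text \<open>Unitriangularity of \<open>T\<close>: it holds on generators, and products of elements
  with leading monomials preserve it.\<close>

lemma T_monomial_leading:
  assumes "S \<subseteq> I"
  shows "leading_monomial S (T (monomial S))"
proof -
  have "finite S" using assms finite_subset by blast
  then show ?thesis using assms
  proof (induction rule: finite_linorder_min_induct)
    case empty
    then show ?case unfolding T_one by (auto simp: leading_monomial_def monomial_def)
  next
    case (insert a A)
    then have a: "a \<in> I" and A: "A \<subseteq> I" by auto
    have "leading_monomial {a} (T (monomial {a}))"
      using a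
    proof (cases rule: generator_cases)
      case 1
      show ?thesis
        unfolding T_gen_alpha[OF 1] by (auto simp: leading_monomial_def monomial_def)
    next
      case (2 i)
      show ?thesis
        \<comment> \<open>The extra term has smaller weight: \<open>i < n + i\<close>, since
          \<open>i \<in> {1..n}\<close> forces \<open>n\<close> to be positive.\<close>
        unfolding 2(2) T_gen_theta[OF 2(1)] using 2(1)
        by (auto simp: leading_monomial_def monomial_def split: if_splits)
    qed
    then have "leading_monomial ({a} \<union> A) (wedge (T (monomial {a})) (T (monomial A)))"
      using insert A by (intro leading_monomial_wedge monomial_insert_min(2)) auto
    then show ?case
      using a A unfolding monomial_insert_min(1)[OF insert(1,2)]
      by (subst T_wedge) (simp_all add: monomial_carrier)
  qed
qed

text \<open>By triangularity, \<open>T\<close> sends a monomial other than the top one to terms of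
  no larger generator sum, never to the top; the top monomial keeps its coefficient 1. Linearity
  gives the rest.\<close>

lemma T_top:
  assumes "f \<in> carrier (exterior_algebra I)"
  shows "T f I = f I"
proof -
  have mono: "T (monomial S) I = monomial S I" if "S \<subseteq> I" for S
  proof (cases "S = I")
    case True
    then show ?thesis
      using T_monomial_leading[of I] by (simp add: leading_monomial_def monomial_def)
  next
    case False
    \<comment> \<open>A nonzero coefficient at \<open>I\<close> would need \<open>I = S\<close> or
      the sum of \<open>I\<close> below that of \<open>S\<close>; both are excluded.\<close>
    have "\<Sum>S \<le> \<Sum>I" using that by (intro sum_mono2) auto
    then show ?thesis
      using T_monomial_leading[OF that] False by (auto simp: leading_monomial_def monomial_def)
  qed
  have "finite I" by simp
  then show ?thesis using assms
  proof (induction rule: exterior_algebra_induct)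
    case zero
    show ?case by (simp add: T_zero)
  next
    case (add S c f)
    then show ?case
      by (simp add: T_add smult_carrier T_smult monomial_carrier mono)
  qed
qed

lemma T_isometry:
  assumes "f \<in> carrier (exterior_algebra I)" "g \<in> carrier (exterior_algebra I)"
  shows "wedge (T f) (T g) I = wedge f g I"
  using T_top[OF wedge_closed[OF assms]] T_wedge[OF assms] by simp

text \<open>The image of \<open>T\<close> is closed under products and linear combinations, so it
  suffices to reach the generators.\<close>

lemma T_surj:
  assumes "f \<in> carrier (exterior_algebra I)"
  shows "f \<in> T ` carrier (exterior_algebra I)"
proof -
  have mono: "monomial S \<in> T ` carrier (exterior_algebra I)" if "S \<subseteq> I" for S
  proof -
    have "finite S" using that finite_subset by blast
    then show ?thesis using that
    proof (induction rule: finite_linorder_min_induct)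
      case empty
      then show ?case using T_one by (intro image_eqI[of _ _ "monomial {}"]) (auto simp: monomial_carrier)
    next
      case (insert a A)
      then have a: "a \<in> I" by auto
      have "monomial {a} \<in> T ` carrier (exterior_algebra I)"
        using a
      proof (cases rule: generator_cases)
        case 1
        then show ?thesis
          using a by (intro image_eqI[of _ _ "monomial {a}"]) (auto simp: T_gen_alpha monomial_carrier)
      next
        case (2 i)
        \<comment> \<open>The inverse shift supplies the preimage: \<theta> minus \<alpha> goes to
          \<theta> because \<alpha> is fixed.\<close>
        have "T (\<lambda>S. monomial {a} S - monomial {i} S) = (\<lambda>S. T (monomial {a}) S - T (monomial {i}) S)"
          using a 2 by (intro T_minus) (auto simp: monomial_carrier)
        then have "monomial {a} = T (\<lambda>S. monomial {a} S - monomial {i} S)"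
          unfolding 2(2) T_gen_theta[OF 2(1)] T_gen_alpha[OF 2(1)] by simp
        moreover have "(\<lambda>S. monomial {a} S - monomial {i} S) \<in> carrier (exterior_algebra I)"
          using a 2 by (intro minus_carrier) (auto simp: monomial_carrier)
        ultimately show ?thesis by (rule image_eqI)
      qed
      then obtain u where u: "u \<in> carrier (exterior_algebra I)" "monomial {a} = T u" by blast
      obtain v where v: "v \<in> carrier (exterior_algebra I)" "monomial A = T v"
        using insert by blast
      have "monomial (insert a A) = T (wedge u v)"
        unfolding monomial_insert_min(1)[OF insert(1,2)] T_wedge[OF u(1) v(1)] u(2) v(2) ..
      then show ?case using wedge_closed[OF u(1) v(1)] by blast
    qed
  qed
  have "finite I" by simp
  then show ?thesis using assms
  proof (induction rule: exterior_algebra_induct)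
    case zero
    then show ?case using T_zero zero_carrier by (intro image_eqI[of _ _ "\<lambda>_. 0"]) auto
  next
    case (add S c f)
    obtain u where u: "u \<in> carrier (exterior_algebra I)" "f = T u" using add by blast
    obtain v where v: "v \<in> carrier (exterior_algebra I)" "monomial S = T v"
      using mono[OF add(1)] by blast
    have "(\<lambda>R. c * monomial S R + f R) = T (\<lambda>R. c * v R + u R)"
      unfolding T_add[OF smult_carrier[OF v(1)] u(1)] T_smult[OF v(1)] u(2) v(2) ..
    then show ?case
      using add_carrier[OF smult_carrier[OF v(1)] u(1)] by (rule image_eqI)
  qed
qed

section \<open>The pairing\<close>

text \<open>The divisor in \<open>vol_pairing\<close> is 1, since \<open>vol n\<close> is the top
  monomial itself.\<close>

lemma vol_pairing_eq: "vol_pairing n f g = wedge f g I"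
  by (simp add: vol_pairing_def vol_eq_monomial monomial_def E_def exterior_algebra_simps(2))

lemma carrier_H0: "carrier (H0 n T) = {f \<in> carrier (exterior_algebra I). T f = f}"
  by (simp add: H0_def E_def)

lemma H0_subspace: "subspace class_ring (carrier (H0 n T)) (exterior_algebra I)"
  unfolding carrier_H0
proof (intro subspace.intro submodule.intro)
  show "vectorspace class_ring (exterior_algebra I)" "Module.module class_ring (exterior_algebra I)"
    by unfold_locales
qed (auto simp: exterior_algebra_simps(4-6) add_carrier smult_carrier zero_carrier T_zero T_add T_smult)

lemma coboundaries_eq: "coboundaries n T = (\<lambda>f S. T f S - f S) ` carrier (exterior_algebra I)"
  by (simp add: coboundaries_def E_def exterior_algebra_minus_eq setcompr_eq_image cong: image_cong_simp)

lemma coboundaries_subspace: "subspace class_ring (coboundaries n T) (exterior_algebra I)"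
proof (intro subspace.intro submodule.intro)
  show "vectorspace class_ring (exterior_algebra I)" "Module.module class_ring (exterior_algebra I)"
    by unfold_locales
  show "coboundaries n T \<subseteq> carrier (exterior_algebra I)"
    by (auto simp: coboundaries_eq minus_carrier T_closed)
  show "\<zero>\<^bsub>exterior_algebra I\<^esub> \<in> coboundaries n T"
    unfolding coboundaries_eq exterior_algebra_simps(4)
    by (rule image_eqI[OF _ zero_carrier]) (simp add: T_zero)
next
  fix v w assume "v \<in> coboundaries n T" "w \<in> coboundaries n T"
  then obtain f g where fg: "f \<in> carrier (exterior_algebra I)" "g \<in> carrier (exterior_algebra I)"
    and v: "v = (\<lambda>S. T f S - f S)" and w: "w = (\<lambda>S. T g S - g S)"
    by (auto simp: coboundaries_eq)
  show "v \<oplus>\<^bsub>exterior_algebra I\<^esub> w \<in> coboundaries n T"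
    unfolding coboundaries_eq exterior_algebra_simps(5)
    by (rule image_eqI[OF _ add_carrier[OF fg]]) (simp add: v w T_add[OF fg] algebra_simps)
next
  fix c :: complex and v assume "v \<in> coboundaries n T"
  then obtain f where f: "f \<in> carrier (exterior_algebra I)" and v: "v = (\<lambda>S. T f S - f S)"
    by (auto simp: coboundaries_eq)
  show "c \<odot>\<^bsub>exterior_algebra I\<^esub> v \<in> coboundaries n T"
    unfolding coboundaries_eq exterior_algebra_simps(6)
    by (rule image_eqI[OF _ smult_carrier[OF f, of c]]) (simp add: v T_smult[OF f] algebra_simps)
qed

text \<open>This is what makes the pairing well defined on classes modulo coboundaries.\<close>

lemma coboundary_orthogonal:
  assumes f: "f \<in> carrier (H0 n T)" and "u \<in> coboundaries n T"
  shows "wedge f u I = 0"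
proof -
  obtain h where h: "h \<in> carrier (exterior_algebra I)" "u = (\<lambda>S. T h S - h S)"
    using assms(2) by (auto simp: coboundaries_eq)
  \<comment> \<open>Invariance allows \<open>f\<close> to be read as \<open>T f\<close>, after which
    \<open>T_isometry\<close> applies.\<close>
  have "wedge f (T h) I = wedge f h I"
    using T_isometry[of f h] f h(1) by (simp add: carrier_H0)
  then show ?thesis
    by (simp add: h(2) wedge_minus_right)
qed

text \<open>Nondegeneracy on the side of \<open>H1\<close>: the functional separating
  \<open>g\<close> from the coboundaries is the pairing with some \<open>f\<close>, and its
  vanishing on coboundaries forces \<open>f\<close> to be invariant.\<close>

lemma exists_invariant_not_orthogonal:
  assumes g: "g \<in> carrier (exterior_algebra I)" "g \<notin> coboundaries n T"
  shows "\<exists>f\<in>carrier (H0 n T). wedge f g I \<noteq> 0"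
proof -
  interpret B: submodule class_ring "coboundaries n T" "exterior_algebra I"
    using coboundaries_subspace by (rule subspace.submod)
  have "\<exists>c. (\<Sum>S\<in>Pow I. c S * g S) \<noteq> 0 \<and> (\<forall>u\<in>coboundaries n T. (\<Sum>S\<in>Pow I. c S * u S) = 0)"
  \<comment> \<open>The coordinates are here indexed by monomials, so the finite index set is
    \<open>Pow I\<close>.\<close>
  proof (rule exists_separating_functional)
    show "x \<in> Pow I" if "f \<in> insert g (coboundaries n T)" "f x \<noteq> 0" for f x
      using that g(1) B.subset by (auto simp: exterior_algebra_simps(1))
    show "(\<lambda>_. 0) \<in> coboundaries n T"
      using B.zero_closed by (simp only: exterior_algebra_simps(4))
    show "(\<lambda>x. u x + v x) \<in> coboundaries n T"
      if "u \<in> coboundaries n T" "v \<in> coboundaries n T" for u v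
      using B.m_closed[OF that] by (simp only: exterior_algebra_simps(5))
    show "(\<lambda>x. c * u x) \<in> coboundaries n T" if "u \<in> coboundaries n T" for c u
      using B.smult_closed[of c, OF _ that] by (simp add: exterior_algebra_simps(6))
  qed (use g in auto)
  then obtain c where c: "(\<Sum>S\<in>Pow I. c S * g S) \<noteq> 0"
    "\<And>u. u \<in> coboundaries n T \<Longrightarrow> (\<Sum>S\<in>Pow I. c S * u S) = 0" by blast
  obtain f where f: "f \<in> carrier (exterior_algebra I)"
    and fw: "\<And>g. wedge f g I = (\<Sum>S\<in>Pow I. c S * g S)"
    using functional_eq_wedge by blast
  have "T f = f"
  proof (rule ccontr)
    assume "T f \<noteq> f"
    then have "(\<lambda>S. T f S - f S) \<noteq> (\<lambda>_. 0)" by (auto simp: fun_eq_iff)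
    with wedge_nondegenerate[OF finite_atLeastAtMost minus_carrier[OF T_closed[OF f] f]]
    obtain k where k: "k \<in> carrier (exterior_algebra I)" "wedge (\<lambda>S. T f S - f S) k I \<noteq> 0"
      by blast
    \<comment> \<open>Writing the test element as \<open>T h\<close> turns its pairing with
      \<open>T f - f\<close> into \<open>\<langle>f, h\<rangle> - \<langle>f, T h\<rangle>\<close>,
      minus the pairing of \<open>f\<close> with a coboundary.\<close>
    obtain h where h: "h \<in> carrier (exterior_algebra I)" "k = T h"
      using T_surj[OF k(1)] by blast
    have "wedge f (\<lambda>S. T h S - h S) I = 0"
      unfolding fw by (rule c(2)) (use h(1) in \<open>auto simp: coboundaries_eq\<close>)
    then have "wedge f (T h) I = wedge f h I"
      by (simp add: wedge_minus_right)
    then show False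
      using k(2) T_isometry[OF f h(1)] by (simp add: h(2) wedge_minus_left)
  qed
  then show ?thesis
    using f c(1) by (intro bexI[of _ f]) (auto simp: fw carrier_H0)
qed

section \<open>The pairing induced on cohomology\<close>

abbreviation coset :: "(nat set \<Rightarrow> complex) \<Rightarrow> (nat set \<Rightarrow> complex) set" where
  "coset g \<equiv> coboundaries n T +>\<^bsub>exterior_algebra I\<^esub> g"

text \<open>A class is given as a set, so a representative has to be chosen; the value does not
  depend on it when \<open>f\<close> is invariant and \<open>X\<close> is a coset.\<close>

definition induced_pairing :: "(nat set \<Rightarrow> complex) \<Rightarrow> (nat set \<Rightarrow> complex) set \<Rightarrow> complex" where
  "induced_pairing f X = vol_pairing n f (SOME g. g \<in> carrier (exterior_algebra I) \<and> X = coset g)"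

text \<open>The chosen representative differs from \<open>g\<close> by a coboundary, which is
  orthogonal to the invariant \<open>f\<close>.\<close>

lemma induced_pairing_coset:
  assumes f: "f \<in> carrier (H0 n T)" and g: "g \<in> carrier (exterior_algebra I)"
  shows "induced_pairing f (coset g) = wedge f g I"
proof -
  define h where "h = (SOME h. h \<in> carrier (exterior_algebra I) \<and> coset g = coset h)"
  have h: "h \<in> carrier (exterior_algebra I) \<and> coset g = coset h"
    unfolding h_def by (rule someI[of _ g]) (use g in auto)
  then have "(\<lambda>S. g S - h S) \<in> coboundaries n T"
    using subspace.rcos_eq_iff[OF coboundaries_subspace g, of h] by (simp add: exterior_algebra_minus_eq)
  then have "wedge f (\<lambda>S. g S - h S) I = 0"
    by (rule coboundary_orthogonal[OF f])
  then show ?thesis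
    by (simp add: induced_pairing_def vol_pairing_eq wedge_minus_right flip: h_def)
qed

lemmas H1_simps = quotient_space_simps[OF coboundaries_subspace, folded E_def H1_def, unfolded E_def]

lemma coset_eq_zero_iff:
  assumes "g \<in> carrier (exterior_algebra I)"
  shows "coset g = \<zero>\<^bsub>H1 n T\<^esub> \<longleftrightarrow> g \<in> coboundaries n T"
  using subspace.rcos_eq_iff[OF coboundaries_subspace assms zero_carrier] assms
  by (simp add: H1_simps(2) exterior_algebra_simps(4) exterior_algebra_minus_eq[OF zero_carrier])

text \<open>On representatives the pairing is the top coefficient of a product, so bilinearity is
  inherited from \<open>wedge\<close>.\<close>

lemma perfect_pairing_induced:
  "perfect_pairing class_ring (H0 n T) (H1 n T) induced_pairing"
proof -
  have H0: "H0 n T = (exterior_algebra I)\<lparr>carrier := carrier (H0 n T)\<rparr>"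
    by (simp add: H0_def E_def)
  have H0_simps: "add (H0 n T) = (\<lambda>f g S. f S + g S)" "zero (H0 n T) = (\<lambda>_. 0)"
    "module.smult (H0 n T) = (\<lambda>c f S. c * f S)"
    by (simp_all add: H0_def E_def exterior_algebra_simps)
  have fin_dim: "V.fin_dim" by (rule exterior_algebra_fin_dim) simp
  have vs0: "vectorspace class_ring (H0 n T)"
    using V.subspace_is_vs[OF H0_subspace] H0 by simp
  have vs1: "vectorspace class_ring (H1 n T)"
    using quotient_space_vectorspace[OF coboundaries_subspace] by (simp add: H1_def E_def)
  interpret W0: vectorspace class_ring "H0 n T" by (rule vs0)
  interpret W1: vectorspace class_ring "H1 n T" by (rule vs1)
  have fd0: "W0.fin_dim"
    using V.fin_dim_subspace[OF fin_dim H0_subspace] H0 by simp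
  have fd1: "W1.fin_dim"
    using quotient_space_fin_dim[OF coboundaries_subspace fin_dim] by (simp add: H1_def E_def)
  have in_E: "f \<in> carrier (exterior_algebra I)" if "f \<in> carrier (H0 n T)" for f
    using that by (simp add: carrier_H0)
  show ?thesis
  proof (intro perfect_pairing.intro bilinear_pairing.intro vs0 vs1
      bilinear_pairing_axioms.intro perfect_pairing_axioms.intro fd0 fd1)
    fix f f' X assume "f \<in> carrier (H0 n T)" "f' \<in> carrier (H0 n T)" "X \<in> carrier (H1 n T)"
    then show "induced_pairing (f \<oplus>\<^bsub>H0 n T\<^esub> f') X =
        induced_pairing f X \<oplus>\<^bsub>class_ring\<^esub> induced_pairing f' X"
      using W0.a_closed[of f f']
      by (auto simp: H1_simps(1) induced_pairing_coset H0_simps wedge_add_left)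
  next
    fix c f X assume "f \<in> carrier (H0 n T)" "X \<in> carrier (H1 n T)"
    then show "induced_pairing (c \<odot>\<^bsub>H0 n T\<^esub> f) X = c \<otimes>\<^bsub>class_ring\<^esub> induced_pairing f X"
      using W0.smult_closed[of c f]
      by (auto simp: H1_simps(1) induced_pairing_coset H0_simps wedge_smult_left)
  next
    fix f X X' assume "f \<in> carrier (H0 n T)" "X \<in> carrier (H1 n T)" "X' \<in> carrier (H1 n T)"
    then show "induced_pairing f (X \<oplus>\<^bsub>H1 n T\<^esub> X') =
        induced_pairing f X \<oplus>\<^bsub>class_ring\<^esub> induced_pairing f X'"
      by (auto simp: H1_simps(1,3) induced_pairing_coset exterior_algebra_simps(5)
          wedge_add_right add_carrier)
  next
    fix c f X assume "f \<in> carrier (H0 n T)" "X \<in> carrier (H1 n T)"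
    then show "induced_pairing f (c \<odot>\<^bsub>H1 n T\<^esub> X) = c \<otimes>\<^bsub>class_ring\<^esub> induced_pairing f X"
      by (auto simp: H1_simps(1,4) induced_pairing_coset exterior_algebra_simps(6)
          wedge_smult_right smult_carrier)
  next
    fix f assume f: "f \<in> carrier (H0 n T)" "f \<noteq> \<zero>\<^bsub>H0 n T\<^esub>"
    \<comment> \<open>Any \<open>g\<close> in the whole algebra serves as witness, since each one
      has a class in \<open>H1\<close>.\<close>
    then obtain g where "g \<in> carrier (exterior_algebra I)" "wedge f g I \<noteq> 0"
      using wedge_nondegenerate[of I f] by (auto simp: carrier_H0 H0_simps)
    then show "\<exists>X\<in>carrier (H1 n T). induced_pairing f X \<noteq> \<zero>\<^bsub>class_ring\<^esub>"
      using f(1) by (auto simp: H1_simps(1) induced_pairing_coset)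
  next
    fix X assume X: "X \<in> carrier (H1 n T)" "X \<noteq> \<zero>\<^bsub>H1 n T\<^esub>"
    then obtain g where g: "g \<in> carrier (exterior_algebra I)" "X = coset g"
      by (auto simp: H1_simps(1))
    then show "\<exists>f\<in>carrier (H0 n T). induced_pairing f X \<noteq> \<zero>\<^bsub>class_ring\<^esub>"
      \<comment> \<open>A nonzero class is represented by an element outside the
        coboundaries.\<close>
      using exists_invariant_not_orthogonal[OF g(1)] X(2)
      by (auto simp: coset_eq_zero_iff induced_pairing_coset)
  qed simp
qed

end

theorem theorem3p8:
  fixes n :: nat and T :: "(nat set \<Rightarrow> complex) \<Rightarrow> nat set \<Rightarrow> complex"
  assumes "n \<ge> 1"
    and "T \<in> algebra_hom class_ring (E n) (E n)"
    and "\<And>i. i \<in> {1..n} \<Longrightarrow> T (theta n i) = theta n i \<oplus>\<^bsub>E n\<^esub> alpha i"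
    and "\<And>i. i \<in> {1..n} \<Longrightarrow> T (alpha i) = alpha i"
  shows "\<exists>p :: (nat set \<Rightarrow> complex) \<Rightarrow> (nat set \<Rightarrow> complex) set \<Rightarrow> complex.
    (\<forall>f\<in>carrier (H0 n T). \<forall>g\<in>carrier (E n).
        p f (coboundaries n T +>\<^bsub>E n\<^esub> g) = vol_pairing n f g) \<and>
    perfect_pairing class_ring (H0 n T) (H1 n T) p"
proof -
  interpret shift_endomorphism n T
    using assms by unfold_locales
  show ?thesis
    using perfect_pairing_induced induced_pairing_coset
    by (intro exI[of _ induced_pairing]) (simp add: vol_pairing_eq E_def)
qed

end
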